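(* Define for integers $k\geq 0$ $$a(k)=\Big(\tfrac12-\tfrac{\sqrt{15}}{15}\Big)\big(2+\sqrt{15}\big)^k+\Big(\tfrac12+\tfrac{\sqrt{15}}{15}\Big)\big(2-\sqrt{15}\big)^k$$ (an integer sequence with $a(0)=1$, $a(1)=0$, $a(k+1)=4a(k)+11a(k-1)$). Then for all integers $n\geq0$, $k\geq0$, $$b_{23}\Big(5^{24k}n+\tfrac{11}{12}\big(5^{24k}-1\big)\Big)\equiv a(12k)\, b_{23}(n)\pmod{23},$$ and for every $r\in\{0,1,2,3\}$ and all $n,k\geq0$, $$b_{23}\Big(5^{24k+24}n+\tfrac{1}{12}\big(5^{24k+23}(12r+7)-11\big)\Big)\equiv 0\pmod{23}.$$
   Context: For an integer $l\geq 2$, a partition of a positive integer $n$ is $l$-regular if none of its parts is divisible by $l$. $b_l(n)$ denotes the number of $l$-regular partitions of $n$, with $b_l(0)=1$; equivalently $\sum_{n\ge0} b_l(n)q^n=\prod_{i\ge1}(1-q^{li})/(1-q^i)$. *)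

theory Defs
  imports Main "HOL-Library.Multiset" "HOL-Number_Theory.Cong"
begin

definition regular_partitions :: "nat \<Rightarrow> nat \<Rightarrow> nat multiset set" where
  "regular_partitions l n =
     {M. (\<forall>x\<in>#M. 0 < x \<and> \<not> l dvd x) \<and> sum_mset M = n}"

definition b :: "nat \<Rightarrow> nat \<Rightarrow> nat" where
  "b l n = card (regular_partitions l n)"

fun a :: "nat \<Rightarrow> int" where
  "a 0 = 1"
| "a (Suc 0) = 0"
| "a (Suc (Suc k)) = 4 * a (Suc k) + 11 * a k"

end

theory Submission
  imports Defs "HOL-Computational_Algebra.Computational_Algebra"
begin

text \<open>
  Modulo 23 the generating function of \<open>b 23\<close> is \<open>E(q)\<^sup>2\<^sup>2\<close> with \<open>E(q) = \<Prod>(1 - q\<^sup>n)\<close>, because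
  \<open>E(q\<^sup>2\<^sup>3) \<equiv> E(q)\<^sup>2\<^sup>3\<close>. The coefficients \<open>d n\<close> of \<open>E\<^sup>2\<^sup>2\<close> satisfy the exact Hecke relation
  \<open>d (25 n + 22) + 5\<^sup>1\<^sup>0 (1 + [n \<equiv> 2 mod 5]) d n + 5\<^sup>2\<^sup>0 d ((n - 22) / 25) = 9630720 d n\<close>, which modulo 23
  is the recurrence of \<open>a\<close> along \<open>n \<mapsto> 25 n + 22\<close>; both congruences then follow from \<open>23 dvd a 13\<close>.

  The Hecke relation needs no modular forms. Write \<open>E = E\<^sub>0 + E\<^sub>1 + E\<^sub>2\<close> according to exponents modulo 5.
  The pentagonal number theorem gives \<open>E\<^sub>1 = - q E(q\<^sup>2\<^sup>5)\<close>, and since no triangular number is 2 modulo 5,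
  Jacobi's formula for \<open>E\<^sup>3\<close> gives \<open>E\<^sub>0 E\<^sub>2 = - E\<^sub>1\<^sup>2\<close>. Hence \<open>E = E\<^sub>0 (1 - y - y\<^sup>2)\<close> with \<open>y = - E\<^sub>1 / E\<^sub>0\<close>,
  and the norm over the fifth roots of unity turns \<open>1 - y - y\<^sup>2\<close> into \<open>1 - 11 y\<^sup>5 - y\<^sup>1\<^sup>0\<close>. With these two
  facts the Hecke relation becomes an identity between integer polynomials in \<open>y\<close>.
\<close>

section \<open>Truncated Euler products\<close>

text \<open>Congruence modulo \<open>fps_X ^ (n + 1)\<close>. It replaces infinite products by
  finite ones, order by order.\<close>

definition eq_upto :: "nat \<Rightarrow> 'a::comm_ring_1 fps \<Rightarrow> 'a fps \<Rightarrow> bool" where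
  "eq_upto n f g \<longleftrightarrow> (\<forall>i\<le>n. f $ i = g $ i)"

lemma eq_upto_refl [simp]: "eq_upto n f f"
  by (simp add: eq_upto_def)

lemma eq_upto_sym: "eq_upto n f g \<Longrightarrow> eq_upto n g f"
  by (simp add: eq_upto_def)

lemma eq_upto_trans [trans]: "eq_upto n f g \<Longrightarrow> eq_upto n g h \<Longrightarrow> eq_upto n f h"
  by (simp add: eq_upto_def)

lemma eq_upto_mono: "eq_upto n f g \<Longrightarrow> m \<le> n \<Longrightarrow> eq_upto m f g"
  by (simp add: eq_upto_def)

lemma eq_upto_mult:
  assumes "eq_upto n f f'" "eq_upto n g g'"
  shows "eq_upto n (f * g) (f' * g')"
  using assms unfolding eq_upto_def fps_mult_nth by (auto intro!: sum.cong)

lemma eq_upto_power: "eq_upto n f g \<Longrightarrow> eq_upto n (f ^ k) (g ^ k)"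
  by (induction k) (auto intro: eq_upto_mult)

lemma eq_upto_prod:
  "(\<And>i. i \<in> S \<Longrightarrow> eq_upto n (f i) (g i)) \<Longrightarrow> eq_upto n (prod f S) (prod g S)"
  by (induction S rule: infinite_finite_induct) (auto intro!: eq_upto_mult)

lemma eq_uptoI_all: "(\<And>n. eq_upto n f g) \<Longrightarrow> f = g"
  by (auto simp: eq_upto_def fps_eq_iff)

lemma eq_upto_one_minus_X_power: "n < k \<Longrightarrow> eq_upto n (1 - fps_X ^ k) 1"
  by (auto simp: eq_upto_def)

lemma eq_upto_X_power_mult:
  "eq_upto n f g \<Longrightarrow> eq_upto (n + k) (fps_X ^ k * f) (fps_X ^ k * g)"
  by (auto simp: eq_upto_def fps_X_power_mult_nth)

definition euler_prod :: "nat \<Rightarrow> 'a::comm_ring_1 fps" where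
  "euler_prod n = (\<Prod>i=1..n. 1 - fps_X ^ i)"

text \<open>The infinite product of all \<open>1 - fps_X ^ i\<close>: factors with
  \<open>i > n\<close> do not affect coefficient \<open>n\<close>, which is therefore already that
  of \<open>euler_prod n\<close>.\<close>

definition euler :: "'a::comm_ring_1 fps" where
  "euler = Abs_fps (\<lambda>n. euler_prod n $ n)"

lemma euler_prod_0 [simp]: "euler_prod 0 = 1"
  by (simp add: euler_prod_def)

lemma euler_prod_Suc: "euler_prod (Suc n) = euler_prod n * (1 - fps_X ^ Suc n)"
  by (simp add: euler_prod_def)

lemma euler_prod_split:
  "m \<le> n \<Longrightarrow> euler_prod n = euler_prod m * (\<Prod>i\<in>{m<..n}. 1 - fps_X ^ i)"
  unfolding euler_prod_def
  by (subst prod.union_disjoint [symmetric]) (auto intro!: prod.cong)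

lemma eq_upto_tail_prod: "eq_upto m (\<Prod>i\<in>{m<..n}. 1 - fps_X ^ i) 1"
  using eq_upto_prod[of "{m<..n}" m "\<lambda>i. 1 - fps_X ^ i" "\<lambda>_. 1"]
  by (simp add: eq_upto_one_minus_X_power)

lemma eq_upto_euler_prods: "m \<le> n \<Longrightarrow> eq_upto m (euler_prod n) (euler_prod m)"
  using eq_upto_mult[OF eq_upto_refl eq_upto_tail_prod] by (simp add: euler_prod_split)

lemma eq_upto_euler: "m \<le> n \<Longrightarrow> eq_upto m euler (euler_prod n)"
  unfolding eq_upto_def euler_def
  using eq_upto_euler_prods[where ?'a='a] by (auto simp: eq_upto_def)

lemma euler_prod_nth_0 [simp]: "euler_prod n $ 0 = 1"
  by (induction n) (simp_all add: euler_prod_Suc)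

lemma euler_nth_0 [simp]: "euler $ 0 = 1"
  by (simp add: euler_def)

section \<open>The pentagonal number theorem\<close>

text \<open>Shanks' finite form of the theorem: the increment of the left-hand side in \<open>n\<close> telescopes over \<open>s\<close>.\<close>

definition shanks_term :: "nat \<Rightarrow> nat \<Rightarrow> 'a::comm_ring_1 fps" where
  "shanks_term n s =
     (-1) ^ s * (\<Prod>i\<in>{s<..n}. 1 - fps_X ^ i) * fps_X ^ (s * n + s * (s + 1) div 2)"

lemma shanks_term_step:
  assumes "s \<le> n"
  shows "shanks_term (Suc n) s = (1 - fps_X ^ Suc n) * fps_X ^ s * shanks_term n s"
proof -
  have "{s<..Suc n} = insert (Suc n) {s<..n}" using assms by auto
  then show ?thesis by (simp add: shanks_term_def power_add algebra_simps)
qed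

lemma shanks_term_shift:
  assumes "s < n"
  shows "(1 - fps_X ^ Suc s) * shanks_term n (Suc s) = - (fps_X ^ (Suc s + n) * shanks_term n s)"
proof -
  have "{s<..n} = insert (Suc s) {Suc s<..n}" using assms by auto
  moreover have "Suc s * n + Suc s * (Suc s + 1) div 2 = Suc s + n + (s * n + s * (s + 1) div 2)"
    by (simp add: algebra_simps)
  ultimately show ?thesis by (simp only: shanks_term_def power_add) (simp add: algebra_simps)
qed

lemma shanks_identity:
  "(\<Sum>s\<le>n. shanks_term n s) =
     1 + (\<Sum>s=1..n. (-1) ^ s * (fps_X ^ (s * (3 * s - 1) div 2) + fps_X ^ (s * (3 * s + 1) div 2)))"
proof (induction n)
  case 0
  then show ?case by (simp add: shanks_term_def)
next
  case (Suc n)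
  let ?T = "shanks_term n :: nat \<Rightarrow> 'a fps"
  have tele: "(\<Sum>s\<le>m. shanks_term (Suc n) s - ?T s) = - (fps_X ^ (n + Suc m) * ?T m)"
    if "m \<le> n" for m
    using that
  proof (induction m)
    case 0
    then show ?case by (simp add: shanks_term_step algebra_simps)
  next
    case (Suc m)
    then have m: "m < n" "m \<le> n" by auto
    have "shanks_term (Suc n) (Suc m) - ?T (Suc m)
        = - ((1 - fps_X ^ Suc m) * ?T (Suc m)) - fps_X ^ (n + Suc (Suc m)) * ?T (Suc m)"
      using Suc.prems by (simp add: shanks_term_step power_add algebra_simps)
    also have "\<dots> = fps_X ^ (n + Suc m) * ?T m - fps_X ^ (n + Suc (Suc m)) * ?T (Suc m)"
      by (simp only: shanks_term_shift[OF m(1)] minus_minus add.commute[of n "Suc m"])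
    finally show ?case using Suc.IH[OF m(2)] by simp
  qed
  \<comment> \<open>What the telescoping leaves over at \<open>s = n\<close>, and the new term
    \<open>s = Suc n\<close>, are the two pentagonal monomials of index
    \<open>Suc n\<close>.\<close>
  have e1: "n + Suc n + (n * n + n * (n + 1) div 2) = Suc n * (3 * Suc n - 1) div 2"
    by (simp add: algebra_simps)
  have e2: "Suc n * Suc n + Suc n * (Suc n + 1) div 2 = Suc n * (3 * Suc n + 1) div 2"
    by (simp add: algebra_simps)
  have "(\<Sum>s\<le>Suc n. shanks_term (Suc n) s :: 'a fps)
      = (\<Sum>s\<le>n. ?T s) - fps_X ^ (n + Suc n) * ?T n + shanks_term (Suc n) (Suc n)"
    using tele[of n] by (simp add: sum_subtractf algebra_simps)
  also have "fps_X ^ (n + Suc n) * ?T n = - ((-1) ^ Suc n * fps_X ^ (Suc n * (3 * Suc n - 1) div 2))"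
    by (simp only: e1 [symmetric] power_add shanks_term_def) (simp add: algebra_simps)
  also have "(shanks_term (Suc n) (Suc n) :: 'a fps)
      = (-1) ^ Suc n * fps_X ^ (Suc n * (3 * Suc n + 1) div 2)"
    by (simp only: shanks_term_def e2) simp
  finally show ?case unfolding Suc.IH by (simp add: algebra_simps del: power_Suc)
qed

text \<open>For \<open>s > 0\<close> the exponent \<open>s * n + s * (s + 1) div 2\<close> exceeds
  \<open>n\<close>, so only the term \<open>s = 0\<close> survives, and it is the Euler
  product.\<close>

lemma eq_upto_shanks: "eq_upto n (euler_prod n) (\<Sum>s\<le>n. shanks_term n s)"
proof -
  have "shanks_term n s $ i = (0 :: 'a)" if "i \<le> n" "s \<noteq> 0" for i s
  proof -
    have "i < s * n + s * (s + 1) div 2"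
    proof (cases s)
      case (Suc k)
      then have "s * (s + 1) div 2 \<ge> 1" by simp
      moreover have "n \<le> s * n" using Suc by simp
      ultimately show ?thesis using that by linarith
    qed (use that in auto)
    then show ?thesis by (simp add: shanks_term_def fps_X_power_mult_right_nth)
  qed
  then have "(\<Sum>s\<in>{..n}. shanks_term n s $ i :: 'a) = (\<Sum>s\<in>{0}. shanks_term n s $ i)" if "i \<le> n" for i
    using that by (intro sum.mono_neutral_right) auto
  moreover have "shanks_term n 0 = (euler_prod n :: 'a fps)"
    by (simp add: shanks_term_def euler_prod_def atLeastSucAtMost_greaterThanAtMost)
  ultimately show ?thesis by (simp add: eq_upto_def fps_sum_nth)
qed

text \<open>Indexing by all integers merges both pentagonal families, \<open>s (3 s - 1) / 2\<close>
  being \<open>pent (- s)\<close>. The value is never negative, so \<open>nat\<close> loses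
  nothing.\<close>

definition pent :: "int \<Rightarrow> nat" where
  "pent s = nat (s * (3 * s + 1) div 2)"

lemma pent_eq: "2 * int (pent s) = s * (3 * s + 1)"
proof -
  have "even (s * (3 * s + 1))" by simp
  moreover have "s * (3 * s + 1) \<ge> 0"
    by (cases "s \<ge> 0") (auto intro!: mult_nonpos_nonpos)
  ultimately show ?thesis by (simp add: pent_def)
qed

lemma pent_inj: "pent s = pent t \<longleftrightarrow> s = t"
proof
  assume "pent s = pent t"
  then have "s * (3 * s + 1) = t * (3 * t + 1)" by (metis pent_eq)
  then have "(s - t) * (3 * (s + t) + 1) = 0" by (simp add: algebra_simps)
  moreover have "3 * (s + t) + 1 \<noteq> 0" by presburger
  ultimately show "s = t" by simp
qed simp

lemma euler_nth_sum:
  assumes "m \<le> n"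
  shows "euler $ m = (\<Sum>s\<in>{-int n..int n}. if pent s = m then (if even s then 1 else -1) else 0)"
proof -
  let ?f = "\<lambda>s::int. if pent s = m then (if even s then 1 else -1) else (0::'a)"
  have p1: "s * (3 * s + 1) div 2 = pent (int s)" for s
    by (simp add: pent_def nat_div_distrib nat_mult_distrib nat_add_distrib)
  have p2: "s * (3 * s - 1) div 2 = pent (- int s)" for s
  proof (cases s)
    case (Suc k)
    have eq: "int (s * (3 * s - 1)) = - int s * (3 * - int s + 1)"
      by (simp add: Suc algebra_simps)
    then show ?thesis unfolding pent_def by (simp only: flip: eq)
  qed (simp add: pent_def)
  have "euler $ m = ((\<Sum>s\<le>n. shanks_term n s) $ m :: 'a)"
    using eq_upto_trans[OF eq_upto_euler[where ?'a='a, OF assms] eq_upto_mono[OF eq_upto_shanks assms]]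
    by (simp add: eq_upto_def)
  also have "\<dots> = ?f 0 + (\<Sum>s=1..n. ?f (- int s) + ?f (int s))"
    unfolding shanks_identity p1 p2
    by (auto simp: fps_sum_nth pent_def[of 0] pent_inj minus_one_power_iff intro!: sum.cong)
  also have "\<dots> = (\<Sum>s\<in>{-int n..int n}. ?f s)"
  proof (induction n)
    case (Suc n)
    have "{-int (Suc n)..int (Suc n)} = insert (-int (Suc n)) (insert (int (Suc n)) {-int n..int n})"
      by auto
    then show ?case using Suc by (simp add: algebra_simps)
  qed simp
  finally show ?thesis .
qed

lemma euler_nth_pent: "euler $ pent s = (if even s then 1 else -1)"
proof -
  \<comment> \<open>Large enough both for coefficient \<open>pent s\<close> to be reached and for
    \<open>s\<close> to lie in the summation range.\<close>
  define n where "n = max (pent s) (nat \<bar>s\<bar>)"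
  have "euler $ pent s = (\<Sum>t\<in>{-int n..int n}. if t = s then (if even s then 1 else -1) else (0::'a))"
    by (subst euler_nth_sum[of _ n]) (auto simp: n_def pent_inj intro!: sum.cong)
  also have "\<dots> = (if even s then 1 else -1)"
    by (subst sum.delta) (auto simp: n_def)
  finally show ?thesis .
qed

lemma euler_nth_not_pent: "m \<notin> range pent \<Longrightarrow> euler $ m = 0"
  by (subst euler_nth_sum[of m m]) (auto intro!: sum.neutral)

section \<open>Jacobi's formula for the cube\<close>

text \<open>
  \<open>jacobi_term n j\<close> is, up to sign, the coefficient of \<open>z\<^sup>j\<^sup>+\<^sup>1\<close> in
  \<open>(1 - z) \<Prod>(1 - z q\<^sup>i) (1 - z\<^sup>-\<^sup>1 q\<^sup>i)\<close>, where \<open>1 \<le> i \<le> n\<close>. The coefficients of \<open>z\<^sup>j\<^sup>+\<^sup>1\<close> and \<open>z\<^sup>-\<^sup>j\<close> are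
  opposite, so the sum in \<open>jacobi_finite\<close> is, up to sign, the derivative of the product at \<open>z = 1\<close>.
\<close>

definition jacobi_term :: "nat \<Rightarrow> nat \<Rightarrow> 'a::field fps" where
  "jacobi_term n j = (if j \<le> n then
     (-1) ^ j * fps_X ^ (j * (j + 1) div 2) * euler_prod (2 * n + 1)
       * (inverse (euler_prod (n - j)) * inverse (euler_prod (n + 1 + j))) else 0)"

lemma inverse_euler_prod_Suc:
  "(inverse (euler_prod n) :: 'a::field fps) = (1 - fps_X ^ Suc n) * inverse (euler_prod (Suc n))"
proof -
  have "inverse (euler_prod (Suc n) :: 'a fps) = inverse (euler_prod n) * inverse (1 - fps_X ^ Suc n)"
    by (simp add: euler_prod_Suc fps_inverse_mult)
  moreover have "inverse (1 - fps_X ^ Suc n) * (1 - fps_X ^ Suc n :: 'a fps) = 1"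
    by (rule inverse_mult_eq_1) simp
  ultimately show ?thesis by (simp add: mult_ac)
qed

lemma triangular_Suc: "Suc j * (Suc j + 1) div 2 = j * (j + 1) div 2 + Suc j"
  by (simp add: algebra_simps)

text \<open>Going from \<open>n\<close> to \<open>Suc n\<close> multiplies the two-sided product by
  \<open>(1 - z Q) (1 - Q / z) = 1 + Q^2 - Q (z + 1 / z)\<close> with
  \<open>Q = fps_X ^ (n + 1)\<close>. This is a comparison of coefficients.\<close>

lemma jacobi_term_Suc:
  "(jacobi_term (Suc n) (Suc j) :: 'a::field fps) =
     (1 + fps_X ^ (2 * n + 2)) * jacobi_term n (Suc j)
       - fps_X ^ (n + 1) * (jacobi_term n j + jacobi_term n (j + 2))"
proof (cases "j \<le> n")
  case True
  define m where "m = n - j"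
  have n: "n = j + m" using True by (simp add: m_def)
  \<comment> \<open>All four terms become \<open>F * g * g'\<close> times a polynomial in
    \<open>q\<close>, \<open>J\<close> and \<open>M\<close>, which leaves a polynomial
    identity.\<close>
  define q J M :: "'a fps" where "q = fps_X" and "J = q ^ j" and "M = q ^ m"
  define g g' :: "'a fps"
    where "g = inverse (euler_prod m)" and "g' = inverse (euler_prod (n + j + 3))"
  define F :: "'a fps" where "F = (-1) ^ j * q ^ (j * (j + 1) div 2) * euler_prod (2 * n + 1)"
  have Q: "fps_X ^ (n + 1) = J * M * q" and Q2: "fps_X ^ (2 * n + 2) = J^2 * M^2 * q^2"
    by (simp_all add: n J_def M_def q_def power_add power_mult power2_eq_square power_mult_distrib mult.commute mult_2)
  have P: "euler_prod (2 * Suc n + 1)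
      = euler_prod (2 * n + 1) * (1 - J^2 * M^2 * q^2) * (1 - J^2 * M^2 * q^3)"
    using euler_prod_Suc[of "2 * n + 2", where ?'a='a] euler_prod_Suc[of "2 * n + 1", where ?'a='a] Q2
    by (simp add: eval_nat_numeral q_def mult_ac)
  have k1: "inverse (euler_prod (n + j + 2)) = (1 - J^2 * M * q^3) * g'"
    using inverse_euler_prod_Suc[of "n + j + 2", where ?'a='a]
    by (simp add: n g'_def J_def M_def q_def power_add eval_nat_numeral mult_ac)
  have k2: "inverse (euler_prod (n + j + 1)) = (1 - J^2 * M * q^2) * (1 - J^2 * M * q^3) * g'"
    using inverse_euler_prod_Suc[of "n + j + 1", where ?'a='a] k1
    by (simp add: n J_def M_def q_def power_add eval_nat_numeral mult_ac)
  have h1: "jacobi_term n (Suc j) = - (F * J * q * (1 - M) * g * (1 - J^2 * M * q^3) * g')"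
  proof (cases m)
    case (Suc i)
    have "inverse (euler_prod i) = (1 - M) * g"
      using inverse_euler_prod_Suc[of i, where ?'a='a] by (simp add: Suc g_def M_def q_def)
    then show ?thesis using k1 unfolding jacobi_term_def triangular_Suc
      by (simp add: n Suc F_def J_def q_def power_add mult_ac)
  qed (simp add: jacobi_term_def n M_def)
  \<comment> \<open>The factor \<open>q\<close> turns \<open>1 - q ^ (m - 1)\<close> into
    \<open>q - M\<close>, avoiding a negative exponent. For \<open>m = 0\<close> and
    \<open>m = 1\<close> both sides vanish.\<close>
  have h2: "jacobi_term n (j + 2) * q = F * J^2 * q^3 * (q - M) * (1 - M) * g * g'"
  proof -
    consider "m = 0" | "m = 1" | i where "m = Suc (Suc i)" by (metis One_nat_def not0_implies_Suc)
    then show ?thesis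
    proof cases
      case (3 i)
      have "inverse (euler_prod i) * q = (q - M) * (1 - M) * g"
      proof -
        define w where "w = q ^ Suc i"
        have "inverse (euler_prod i) = (1 - w) * inverse (euler_prod (Suc i))"
          unfolding q_def w_def by (rule inverse_euler_prod_Suc)
        moreover have "inverse (euler_prod (Suc i)) = (1 - M) * g"
          unfolding q_def M_def g_def 3 by (rule inverse_euler_prod_Suc)
        moreover have "q * w = M"
          by (simp add: M_def w_def 3)
        ultimately show ?thesis by algebra
      qed
      moreover have "jacobi_term n (j + 2) = F * (J^2 * q^3) * (inverse (euler_prod i) * g')"
      proof -
        have tri: "(j + 2) * (j + 2 + 1) div 2 = j * (j + 1) div 2 + (j * 2 + 3)"
          by (simp add: algebra_simps)
        have "n - (j + 2) = i" "j + 2 \<le> n" "n + 1 + (j + 2) = n + j + 3" using n 3 by auto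
        moreover have "fps_X ^ (j * (j + 1) div 2 + (j * 2 + 3)) = fps_X ^ (j * (j + 1) div 2) * (J^2 * q^3)"
          by (simp only: power_add power_mult J_def q_def)
        ultimately show ?thesis unfolding jacobi_term_def g'_def F_def tri
          by (simp add: q_def mult_ac numeral_3_eq_3)
      qed
      ultimately show ?thesis by algebra
    qed (simp_all add: jacobi_term_def n M_def)
  qed
  have h0: "jacobi_term n j = F * g * (1 - J^2 * M * q^2) * (1 - J^2 * M * q^3) * g'"
    using k2 by (simp add: jacobi_term_def n F_def g_def q_def mult_ac add_ac)
  have h': "jacobi_term (Suc n) (Suc j)
      = - (F * J * q * (1 - J^2 * M^2 * q^2) * (1 - J^2 * M^2 * q^3) * g * g')"
    unfolding jacobi_term_def triangular_Suc P
    by (simp add: n F_def J_def q_def g_def g'_def power_add mult_ac eval_nat_numeral)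
  have "q * jacobi_term (Suc n) (Suc j) = q * ((1 + fps_X ^ (2 * n + 2)) * jacobi_term n (Suc j)
       - fps_X ^ (n + 1) * (jacobi_term n j + jacobi_term n (j + 2)))"
    using h2 unfolding h' h1 h0 Q Q2 by algebra
  then show ?thesis by (simp add: q_def)
qed (simp add: jacobi_term_def)

text \<open>The same comparison at \<open>z ^ 1\<close>. Its lower neighbour \<open>z ^ 0\<close>
  has the opposite coefficient, hence \<open>- jacobi_term n 0\<close>.\<close>

lemma jacobi_term_0:
  "(jacobi_term (Suc n) 0 :: 'a::field fps) =
     (1 + fps_X ^ (2 * n + 2)) * jacobi_term n 0
       - fps_X ^ (n + 1) * (jacobi_term n 1 - jacobi_term n 0)"
proof -
  define q N :: "'a fps" where "q = fps_X" and "N = q ^ n"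
  define g g' :: "'a fps"
    where "g = inverse (euler_prod (n + 1))" and "g' = inverse (euler_prod (n + 2))"
  define F :: "'a fps" where "F = euler_prod (2 * n + 1)"
  have Q: "fps_X ^ (n + 1) = N * q" and Q2: "fps_X ^ (2 * n + 2) = N^2 * q^2"
    by (simp_all add: N_def q_def power_add power_mult power2_eq_square power_mult_distrib mult.commute mult_2)
  have P: "euler_prod (2 * Suc n + 1) = F * (1 - N^2 * q^2) * (1 - N^2 * q^3)"
    using euler_prod_Suc[of "2 * n + 2", where ?'a='a] euler_prod_Suc[of "2 * n + 1", where ?'a='a] Q2
    by (simp add: F_def eval_nat_numeral q_def mult_ac)
  have k1: "inverse (euler_prod (n + 1)) = (1 - N * q^2) * g'"
    using inverse_euler_prod_Suc[of "n + 1", where ?'a='a]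
    by (simp add: g'_def N_def q_def power_add eval_nat_numeral mult_ac)
  have k2: "inverse (euler_prod n) = (1 - N * q) * g"
    using inverse_euler_prod_Suc[of n, where ?'a='a] by (simp add: g_def N_def q_def mult_ac)
  have h0: "jacobi_term n 0 = F * (1 - N * q) * g * (1 - N * q^2) * g'"
    using k1 k2 by (simp add: jacobi_term_def F_def mult_ac)
  have h1: "jacobi_term n 1 = - (q * F * (1 - N) * (1 - N * q) * g * g')"
  proof (cases n)
    case (Suc i)
    have "inverse (euler_prod i) = (1 - N) * (1 - N * q) * g"
      using inverse_euler_prod_Suc[of i, where ?'a='a] k2 by (simp add: Suc N_def q_def mult_ac)
    then show ?thesis by (simp add: jacobi_term_def Suc F_def g'_def q_def mult_ac)
  qed (simp add: jacobi_term_def N_def)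
  have h': "jacobi_term (Suc n) 0 = F * (1 - N^2 * q^2) * (1 - N^2 * q^3) * g * g'"
    unfolding jacobi_term_def P by (simp add: g_def g'_def mult_ac)
  show ?thesis unfolding h' h1 h0 Q Q2 by algebra
qed

lemma jacobi_finite:
  "(\<Sum>j\<le>n. of_nat (2 * j + 1) * jacobi_term n j) = (euler_prod n ^ 2 :: 'a::field fps)"
proof (induction n)
  case 0
  have "inverse (1 - fps_X) * (1 - fps_X :: 'a fps) = 1"
    by (rule inverse_mult_eq_1) simp
  then show ?case by (simp add: jacobi_term_def euler_prod_Suc mult.commute)
next
  case (Suc n)
  let ?h = "jacobi_term n :: nat \<Rightarrow> 'a fps"
  define S T where "S = (\<Sum>j\<le>n. of_nat (2 * j + 1) * ?h j)" and "T = (\<Sum>j\<le>n. ?h j)"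
  define S1 S2 where "S1 = (\<Sum>j\<le>n. of_nat (2 * j + 3) * ?h (Suc j))"
    and "S2 = (\<Sum>j\<le>n. of_nat (2 * j + 3) * ?h (j + 2))"
  define Q :: "'a fps" where "Q = fps_X ^ (n + 1)"
  have "(n + 1) * 2 = 2 * n + 2" by simp
  then have Q2: "fps_X ^ (2 * n + 2) = Q^2"
    unfolding Q_def power_mult [symmetric] by (rule arg_cong [OF sym])
  \<comment> \<open>The default value 0 beyond \<open>n\<close> lets shifted sums keep the range
    \<open>j \<le> n\<close>.\<close>
  have z: "?h j = 0" if "j > n" for j using that by (simp add: jacobi_term_def)
  have shift: "(\<Sum>j\<le>n. c j * ?h j) = c 0 * ?h 0 + (\<Sum>j\<le>n. c (Suc j) * ?h (Suc j))" for c
    using sum.atMost_Suc_shift[of "\<lambda>j. c j * ?h j" n] by (simp add: z)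
  have shift2: "(\<Sum>j\<le>n. c j * ?h (Suc j)) = c 0 * ?h 1 + (\<Sum>j\<le>n. c (Suc j) * ?h (j + 2))" for c
    using sum.atMost_Suc_shift[of "\<lambda>j. c j * ?h (Suc j)" n] by (simp add: z)
  have S1: "S1 = S - ?h 0"
    using shift[of "\<lambda>j. of_nat (2 * j + 1)"] by (simp add: S_def S1_def algebra_simps)
  have "(\<Sum>j\<le>n. of_nat (2 * j + 3) * ?h j) = (\<Sum>j\<le>n. of_nat (2 * j + 1) * ?h j + 2 * ?h j)"
    by (rule sum.cong) (simp_all add: algebra_simps)
  then have S0: "(\<Sum>j\<le>n. of_nat (2 * j + 3) * ?h j) = S + 2 * T"
    by (simp add: S_def T_def sum.distrib sum_distrib_left)
  have "(\<Sum>j\<le>n. of_nat (2 * j + 3) * ?h (j + 2)) + 2 * (\<Sum>j\<le>n. ?h (j + 2))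
      = (\<Sum>j\<le>n. of_nat (2 * j + 5) * ?h (j + 2))"
    unfolding sum_distrib_left sum.distrib [symmetric]
    by (rule sum.cong) (simp_all add: algebra_simps)
  also have "\<dots> = S1 - 3 * ?h 1"
    using shift2[of "\<lambda>j. of_nat (2 * j + 3)"] by (simp add: S1_def algebra_simps)
  also have "(\<Sum>j\<le>n. ?h (j + 2)) = T - ?h 0 - ?h 1"
    using shift[of "\<lambda>_. 1"] shift2[of "\<lambda>_. 1"] by (simp add: T_def)
  finally have S2: "S2 = S - 2 * T + ?h 0 - ?h 1"
    by (simp add: S1 S2_def algebra_simps)
  have "(\<Sum>j\<le>Suc n. of_nat (2 * j + 1) * jacobi_term (Suc n) j :: 'a fps)
     = jacobi_term (Suc n) 0 + (\<Sum>j\<le>n. of_nat (2 * j + 3) * jacobi_term (Suc n) (Suc j))"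
    by (subst sum.atMost_Suc_shift) (simp add: algebra_simps)
  also have "(\<Sum>j\<le>n. of_nat (2 * j + 3) * jacobi_term (Suc n) (Suc j) :: 'a fps)
     = (\<Sum>j\<le>n. (1 + Q^2) * (of_nat (2 * j + 3) * ?h (Suc j))
         - Q * (of_nat (2 * j + 3) * ?h j + of_nat (2 * j + 3) * ?h (j + 2)))"
    unfolding jacobi_term_Suc Q2 Q_def [symmetric]
    by (rule sum.cong) (simp_all add: algebra_simps)
  also have "\<dots> = (1 + Q^2) * S1 - Q * (S + 2 * T + S2)"
    unfolding S0 [symmetric] by (simp only: S1_def S2_def sum_subtractf sum.distrib flip: sum_distrib_left)
  also have "jacobi_term (Suc n) 0 = (1 + Q^2) * ?h 0 - Q * (?h 1 - ?h 0)"
    unfolding jacobi_term_0 Q2 Q_def [symmetric] ..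
  \<comment> \<open>As expected: the product vanishes at \<open>z = 1\<close>, so the two new
    factors multiply its derivative there by their own value \<open>(1 - Q)^2\<close>.\<close>
  finally have "(\<Sum>j\<le>Suc n. of_nat (2 * j + 1) * jacobi_term (Suc n) j :: 'a fps) = (1 - Q)^2 * S"
    unfolding S1 S2 by (simp add: algebra_simps power2_eq_square)
  then show ?case
    using Suc.IH by (simp add: S_def Q_def euler_prod_Suc power_mult_distrib mult.commute)
qed

text \<open>One more factor \<open>euler_prod n\<close> on both sides of
  \<open>jacobi_finite\<close> makes the right side a cube and each \<open>jacobi_term n j\<close> a
  signed monomial up to order \<open>n\<close>.\<close>

lemma euler_cube_nth:
  assumes "m \<le> n"
  shows "((euler :: 'a::field fps) ^ 3) $ m = (\<Sum>j\<le>n. if j * (j + 1) div 2 = m then (-1) ^ j * of_nat (2 * j + 1) else 0)"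
proof -
  have main: "eq_upto n (euler_prod n * jacobi_term n j) ((-1) ^ j * fps_X ^ (j * (j + 1) div 2) :: 'a fps)"
    if j: "j \<le> n" for j
  proof -
    define A B :: "'a fps" where "A = (\<Prod>i\<in>{n-j<..n}. 1 - fps_X ^ i)"
      and "B = (\<Prod>i\<in>{n+1+j<..2*n+1}. 1 - fps_X ^ i)"
    have inv: "euler_prod k * inverse (euler_prod k) = (1 :: 'a fps)" for k
      by (rule inverse_mult_eq_1') simp
    have "euler_prod n * inverse (euler_prod (n - j)) = A"
      using euler_prod_split[of "n - j" n, where ?'a='a] inv[of "n - j"]
      by (simp add: A_def mult_ac)
    moreover have "euler_prod (2 * n + 1) * inverse (euler_prod (n + 1 + j)) = B"
      using euler_prod_split[of "n + 1 + j" "2 * n + 1", where ?'a='a] inv[of "n + 1 + j"] j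
      by (simp add: B_def mult_ac)
    ultimately have "euler_prod n * jacobi_term n j = fps_X ^ (j * (j + 1) div 2) * ((-1) ^ j * (A * B))"
      using j unfolding jacobi_term_def by (simp add: mult_ac)
    moreover have "eq_upto (n - j) A 1" "eq_upto (n - j) B 1"
      unfolding A_def B_def by (rule eq_upto_tail_prod eq_upto_mono[OF eq_upto_tail_prod], simp)+
    then have "eq_upto (n - j) ((-1) ^ j * (A * B)) ((-1) ^ j * (1 * 1))"
      by (intro eq_upto_mult eq_upto_refl)
    then have "eq_upto (n - j + j * (j + 1) div 2)
        (fps_X ^ (j * (j + 1) div 2) * ((-1) ^ j * (A * B))) (fps_X ^ (j * (j + 1) div 2) * ((-1) ^ j * (1 * 1)))"
      by (rule eq_upto_X_power_mult)
    \<comment> \<open>\<open>A\<close> and \<open>B\<close> are only known to be 1 up to order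
      \<open>n - j\<close>. The monomial in front has degree at least \<open>j\<close> and makes up
      the difference.\<close>
    moreover have "n \<le> n - j + j * (j + 1) div 2"
    proof (cases j)
      case (Suc i)
      then show ?thesis using j triangular_Suc[of i] by simp
    qed simp
    ultimately show ?thesis by (auto intro: eq_upto_mono simp: mult.commute)
  qed
  have "eq_upto n (euler ^ 3 :: 'a fps) (euler_prod n ^ 3)"
    by (intro eq_upto_power eq_upto_euler) simp
  then have "(euler ^ 3 :: 'a fps) $ m = (euler_prod n * euler_prod n ^ 2) $ m"
    using assms by (simp add: eq_upto_def power2_eq_square power3_eq_cube mult.assoc)
  also have "\<dots> = (\<Sum>j\<le>n. (of_nat (2 * j + 1) * (euler_prod n * jacobi_term n j)) $ m)"
    unfolding jacobi_finite [symmetric] by (simp add: sum_distrib_left fps_sum_nth mult_ac)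
  also have "\<dots> = (\<Sum>j\<le>n. (of_nat (2 * j + 1) * ((-1) ^ j * fps_X ^ (j * (j + 1) div 2))) $ m)"
    using eq_upto_mult[OF eq_upto_refl main] assms
    by (intro sum.cong) (simp_all add: eq_upto_def)
  also have "\<dots> = (\<Sum>j\<le>n. if j * (j + 1) div 2 = m then (-1) ^ j * of_nat (2 * j + 1) else 0)"
    by (intro sum.cong) (auto simp: minus_one_power_iff fps_mult_of_nat_nth(1) simp flip: of_nat_Suc)
  finally show ?thesis .
qed

section \<open>Dissection modulo 5\<close>

abbreviation fps_dilate :: "'a::comm_ring_1 fps \<Rightarrow> 'a fps" where
  "fps_dilate f \<equiv> f oo fps_X ^ 5"

lemma fps_dilate_mult: "fps_dilate (f * g) = fps_dilate f * fps_dilate (g :: 'a::idom fps)"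
  by (rule fps_compose_mult_distrib) simp

lemma fps_dilate_power: "fps_dilate (f ^ k) = fps_dilate (f :: 'a::idom fps) ^ k"
  by (rule fps_compose_power [symmetric]) simp

lemma fps_dilate_X_power: "fps_dilate (fps_X ^ k :: 'a::idom fps) = fps_X ^ (5 * k)"
  by (simp add: fps_dilate_power flip: power_mult)

definition fps_sect :: "nat \<Rightarrow> 'a::comm_ring_1 fps \<Rightarrow> 'a fps" where
  "fps_sect r f = Abs_fps (\<lambda>n. f $ (5 * n + r))"

lemma fps_sect_nth [simp]: "fps_sect r f $ n = f $ (5 * n + r)"
  by (simp add: fps_sect_def)

lemma fps_sect_add: "fps_sect r (f + g) = fps_sect r f + fps_sect r g"
  by (simp add: fps_eq_iff)

lemma fps_sect_dilate: "fps_sect 0 (fps_dilate f) = f"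
  by (simp add: fps_eq_iff fps_nth_compose_X_power)

lemma fps_dilate_inj: "fps_dilate f = fps_dilate g \<Longrightarrow> f = g"
  by (metis fps_sect_dilate)

lemma fps_sect_dilate_Suc: "Suc r < 5 \<Longrightarrow> fps_sect (Suc r) (fps_dilate f) = 0"
  by (auto simp: fps_eq_iff fps_nth_compose_X_power) presburger

lemma fps_sect_X_mult_0: "fps_sect 0 (fps_X * f) = fps_X * fps_sect 4 f"
proof (rule fps_ext)
  fix n show "fps_sect 0 (fps_X * f) $ n = (fps_X * fps_sect 4 f) $ n"
    by (cases n) (simp_all add: add.commute)
qed

lemma fps_sect_X_mult_Suc: "fps_sect (Suc r) (fps_X * f) = fps_sect r f"
  by (simp add: fps_eq_iff)

text \<open>A series in \<open>fps_X ^ 5\<close> preserves residue classes of exponents, so it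
  leaves the section as an undilated factor.\<close>

lemma fps_sect_mult_dilate:
  assumes "r < 5"
  shows "fps_sect r (fps_dilate g * f) = g * fps_sect r f"
proof (rule fps_ext)
  fix n
  have "fps_sect r (fps_dilate g * f) $ n =
      (\<Sum>i=0..5*n+r. (if 5 dvd i then g $ (i div 5) else 0) * f $ (5 * n + r - i))"
    by (simp add: fps_mult_nth fps_nth_compose_X_power)
  also have "\<dots> = (\<Sum>i\<in>(*) 5 ` {0..n}. (if 5 dvd i then g $ (i div 5) else 0) * f $ (5 * n + r - i))"
    using assms by (intro sum.mono_neutral_right) (auto elim!: dvdE)
  also have "\<dots> = (\<Sum>i=0..n. g $ i * f $ (5 * n + r - 5 * i))"
    by (subst sum.reindex) (auto simp: inj_on_def)
  also have "\<dots> = (g * fps_sect r f) $ n"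
    unfolding fps_mult_nth by (intro sum.cong) (auto simp: diff_mult_distrib2)
  finally show "fps_sect r (fps_dilate g * f) $ n = (g * fps_sect r f) $ n" .
qed

lemma fps_X_power_dilate_nth:
  assumes "k < 5" "r < 5"
  shows "(fps_X ^ k * fps_dilate f) $ (5 * m + r) = (if k = r then f $ m else 0)"
proof (cases "k = r")
  case False
  have "\<not> 5 dvd 5 * m + r - k" if le: "k \<le> 5 * m + r"
  proof
    assume "5 dvd 5 * m + r - k"
    then obtain q where "5 * m + r - k = 5 * q" by (rule dvdE)
    with le have "5 * m + r = 5 * q + k" by simp
    then have "(5 * m + r) mod 5 = (5 * q + k) mod 5" by simp
    with False assms show False by simp
  qed
  with False show ?thesis
    by (auto simp: fps_X_power_mult_nth fps_nth_compose_X_power)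
qed (simp add: fps_X_power_mult_nth fps_nth_compose_X_power)

lemma fps_sect_decomposition:
  "f = fps_dilate (fps_sect 0 f) + fps_X * fps_dilate (fps_sect 1 f)
     + fps_X ^ 2 * fps_dilate (fps_sect 2 f) + fps_X ^ 3 * fps_dilate (fps_sect 3 f)
     + fps_X ^ 4 * fps_dilate (fps_sect 4 f)" (is "f = ?g")
proof (rule fps_ext)
  fix n :: nat
  define m r where "m = n div 5" and "r = n mod 5"
  have n: "n = 5 * m + r" by (simp add: m_def r_def)
  have r: "r < 5" by (simp add: r_def)
  have cf: "(fps_X ^ k * fps_dilate g) $ n = (if k = r then g $ m else 0)" if "k < 5" for k and g :: "'a fps"
    unfolding n using that r by (rule fps_X_power_dilate_nth)
  have cf0: "fps_dilate g $ n = (if r = 0 then g $ m else 0)"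
    and cf1: "(fps_X * fps_dilate g) $ n = (if r = 1 then g $ m else 0)" for g :: "'a fps"
    using cf[of 0 g] cf[of 1 g] by auto
  have poly_sect: "fps_sect r f $ m = f $ n" by (simp add: n)
  have "r \<in> {0, 1, 2, 3, 4}" using r by auto
  then show "f $ n = ?g $ n"
    using poly_sect by (auto simp del: fps_sect_nth fps_X_mult_nth One_nat_def simp add: cf cf0 cf1)
qed

section \<open>Residues modulo 5 of the exponents in the Euler product and its cube\<close>

lemma pent_mod_5: "pent s mod 5 \<in> {0, 1, 2}" "pent s mod 5 = 1 \<longleftrightarrow> s mod 5 = 4"
proof -
  let ?r = "s mod 5"
  \<comment> \<open>3 is the inverse of 2 modulo 5, so \<open>pent_eq\<close> yields
    \<open>pent s\<close> modulo 5.\<close>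
  have "x mod 5 = 3 * (2 * x mod 5) mod 5" for x :: int by presburger
  then have "int (pent s mod 5) = 3 * (s * (3 * s + 1) mod 5) mod 5"
    unfolding of_nat_mod pent_eq [symmetric] by simp
  also have "s * (3 * s + 1) mod 5 = ?r * (3 * ?r + 1) mod 5"
  proof (rule mod_mult_cong)
    show "(3 * s + 1) mod 5 = (3 * ?r + 1) mod 5"
      by (metis mod_add_left_eq mod_mult_right_eq)
  qed simp
  finally have "int (pent s mod 5) = 3 * (?r * (3 * ?r + 1) mod 5) mod 5" .
  moreover have "?r \<in> {0, 1, 2, 3, 4}" by auto
  ultimately show "pent s mod 5 \<in> {0, 1, 2}" "pent s mod 5 = 1 \<longleftrightarrow> ?r = 4"
    by auto
qed

text \<open>\<open>24 * pent s + 1 = (6 s + 1)^2\<close>, and \<open>s = - 5 t - 1\<close>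
  multiplies \<open>6 t + 1\<close> by \<open>- 5\<close>.\<close>

lemma pent_dilate: "pent (- 5 * t - 1) = 25 * pent t + 1"
proof -
  have "2 * int (pent (- 5 * t - 1)) = 2 * int (25 * pent t + 1)"
    using pent_eq[of "- 5 * t - 1"] pent_eq[of t] by (simp add: algebra_simps)
  then show ?thesis by (simp only: mult_cancel_left of_nat_eq_iff) simp
qed

lemma fps_sect_euler_34: "fps_sect 3 euler = 0" "fps_sect 4 euler = 0"
proof -
  have "pent s \<noteq> 5 * n + r" if "r \<in> {3, 4}" for s n r
  proof
    assume "pent s = 5 * n + r"
    then have "pent s mod 5 = r" using that by auto
    with that pent_mod_5(1)[of s] show False by auto
  qed
  then have "pent s \<noteq> 5 * n + 3" "pent s \<noteq> 5 * n + 4" for s n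
    by simp_all
  then have "5 * n + 3 \<notin> range pent" "5 * n + 4 \<notin> range pent" for n
    by (metis imageE)+
  then show "fps_sect 3 euler = 0" "fps_sect 4 euler = 0"
    by (simp_all add: fps_eq_iff euler_nth_not_pent)
qed

text \<open>Pentagonal exponents that are 1 modulo 5 are exactly those of
  \<open>pent_dilate\<close>. The minus sign arises because \<open>- 5 t - 1\<close> and
  \<open>t\<close> have opposite parity.\<close>

lemma fps_sect_euler_1: "fps_sect 1 euler = - fps_dilate euler"
proof (rule fps_ext)
  fix n
  show "fps_sect 1 euler $ n = (- fps_dilate euler :: 'a fps) $ n"
  proof (cases "\<exists>t. n = 5 * pent t")
    case True
    then obtain t where n: "n = 5 * pent t" ..
    have "euler $ (5 * n + 1) = (euler :: 'a fps) $ pent (- 5 * t - 1)"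
      by (simp only: pent_dilate n) simp
    also have "\<dots> = - (euler $ pent t)"
      by (simp add: euler_nth_pent)
    finally show ?thesis by (simp add: n fps_nth_compose_X_power)
  next
    case False
    have "5 * n + 1 \<notin> range pent"
    proof
      assume "5 * n + 1 \<in> range pent"
      then obtain s where s: "5 * n + 1 = pent s" by auto
      then have "pent s mod 5 = 1" by presburger
      then have "s mod 5 = 4" by (simp only: pent_mod_5(2))
      then have "s = - 5 * (- ((s + 1) div 5)) - 1" by presburger
      then have "pent s = 25 * pent (- ((s + 1) div 5)) + 1" by (metis pent_dilate)
      with s False show False by auto
    qed
    moreover have "n div 5 \<notin> range pent" if "5 dvd n"
      using False that by auto
    ultimately show ?thesis
      by (simp add: fps_nth_compose_X_power euler_nth_not_pent)
  qed
qed

text \<open>A triangular number congruent to 2 modulo 5 would need \<open>j (j + 1)\<close>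
  congruent to 4, but only 0, 1 and 2 occur.\<close>

lemma fps_sect_2_euler_cube: "fps_sect 2 ((euler :: 'a::field fps) ^ 3) = 0"
proof -
  have "j * (j + 1) div 2 \<noteq> 5 * n + 2" for j n :: nat
  proof
    assume "j * (j + 1) div 2 = 5 * n + 2"
    then have "j * (j + 1) = 2 * (5 * n + 2)" by (metis dvd_mult_div_cancel even_mult_iff even_plus_one_iff)
    then have "j * (j + 1) mod 5 = 4" by presburger
    moreover have "j * (j + 1) mod 5 = (j mod 5) * (j mod 5 + 1) mod 5"
      by (rule mod_mult_cong[OF mod_mod_trivial [symmetric] mod_add_left_eq [symmetric]])
    moreover have "j mod 5 \<in> {0, 1, 2, 3, 4}" by auto
    ultimately show False by auto
  qed
  then show ?thesis by (simp add: fps_eq_iff euler_cube_nth[OF order_refl] del: of_nat_add of_nat_mult)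
qed

section \<open>Polynomial identities\<close>

text \<open>Polynomial counterpart of \<open>fps_sect\<close>, computable by the
  \<open>pCons\<close> rules below. The list is long enough because \<open>5 * m + r\<close> exceeds
  the degree once \<open>m\<close> does.\<close>

definition poly_sect :: "nat \<Rightarrow> 'a::zero poly \<Rightarrow> 'a poly" where
  "poly_sect r p = Poly (map (\<lambda>m. coeff p (5 * m + r)) [0..<Suc (degree p)])"

lemma coeff_poly_sect: "coeff (poly_sect r p) m = coeff p (5 * m + r)"
  by (auto simp: poly_sect_def nth_default_def coeff_eq_0 simp del: upt_Suc)

lemma poly_sect_0 [simp]: "poly_sect r 0 = 0"
  by (simp add: poly_eq_iff coeff_poly_sect)

lemma poly_sect_pCons_0: "poly_sect 0 (pCons c p) = pCons c (poly_sect 4 p)"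
proof (rule poly_eqI)
  fix m show "coeff (poly_sect 0 (pCons c p)) m = coeff (pCons c (poly_sect 4 p)) m"
  proof (cases m)
    case (Suc k)
    have "5 * Suc k + 0 = Suc (5 * k + 4)" by simp
    then show ?thesis unfolding Suc coeff_poly_sect by (simp only: coeff_pCons_Suc coeff_poly_sect)
  qed (simp add: coeff_poly_sect)
qed

lemma poly_sect_pCons_Suc: "poly_sect (Suc r) (pCons c p) = poly_sect r p"
  by (rule poly_eqI) (simp add: coeff_poly_sect)

lemma poly_sect_pCons_numeral: "poly_sect (numeral k) (pCons c p) = poly_sect (pred_numeral k) p"
  by (simp add: numeral_eq_Suc poly_sect_pCons_Suc)

lemmas poly_sect_pCons = poly_sect_pCons_0 poly_sect_pCons_Suc poly_sect_pCons_numeral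

definition poly_dilate :: "'a::comm_semiring_1 poly \<Rightarrow> 'a poly" where
  "poly_dilate p = pcompose p (monom 1 5)"

lemma poly_dilate_0 [simp]: "poly_dilate 0 = 0"
  by (simp add: poly_dilate_def)

lemma poly_dilate_pCons [simp]:
  "poly_dilate (pCons c p) = pCons c (pCons 0 (pCons 0 (pCons 0 (pCons 0 (poly_dilate p)))))"
  by (simp add: poly_dilate_def pcompose_pCons monom_altdef eval_nat_numeral)

text \<open>
  The roots of \<open>golden5\<close> are the fifth powers of those of \<open>golden\<close>. The coefficients below are found by
  expanding sections of powers of \<open>golden\<close> in \<open>monom 1 i * golden5 ^ (4 - i)\<close>.
\<close>

definition golden :: "int poly" where "golden = [:1, -1, -1:]"
definition golden5 :: "int poly" where "golden5 = [:1, -11, -1:]"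

lemma poly_sect_2_golden_power:
  "poly_sect 2 (golden ^ 22) = monom 209 0 * golden5 ^ 4 + monom 52250 1 * golden5 ^ 3
     + monom 653125 2 * golden5 ^ 2 + monom (- 9765625) 4"
  by (simp add: golden_def golden5_def poly_sect_pCons monom_altdef power_numeral_even power_numeral_odd)

text \<open>The second sectioning step, applied term by term to the preceding expansion:
  \<open>monom 1 i * golden ^ (24 - 6 * i)\<close> stands for
  \<open>fps_X ^ i * euler ^ (24 - 6 * i)\<close>, and \<open>golden5 ^ i\<close> for the factor
  \<open>euler ^ (6 * i)\<close> that was dilated before sectioning.\<close>

lemma poly_sect_4_combination:
  "monom 209 0 * poly_sect 4 (monom 1 0 * golden ^ 24) + monom 52250 0 * golden5 * poly_sect 4 (monom 1 1 * golden ^ 18)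
     + monom 653125 0 * golden5 ^ 2 * poly_sect 4 (monom 1 2 * golden ^ 12)
     + monom (- 9765625) 0 * golden5 ^ 4 * poly_sect 4 (monom 1 4 * golden ^ 0)
   = monom (- 134905) 0 * golden5 ^ 4 + monom (- 2041015625) 2 * golden5 ^ 2
     + monom (- 20410156250) 3 * golden5 + monom (- 10205078125) 4"
  by (simp add: golden_def golden5_def poly_sect_pCons monom_altdef power_numeral_even power_numeral_odd)

text \<open>The Hecke relation times \<open>euler ^ 2\<close>, divided by
  \<open>fps_dilate \<alpha> ^ 24\<close> and written in \<open>y = fps_X * fps_dilate c\<close>.
  Dilated quantities are polynomials in \<open>y ^ 5\<close>, whence
  \<open>poly_dilate\<close>.\<close>

lemma hecke_polynomial_identity:
  "monom (- 134905) 0 * golden ^ 24 + monom (- 2041015625) 2 * golden ^ 12 * poly_dilate golden5 ^ 2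
     + monom (- 20410156250) 3 * golden ^ 6 * poly_dilate golden5 ^ 3
     + monom (- 10205078125) 4 * poly_dilate golden5 ^ 4
     + monom (5 ^ 10) 0 * golden ^ 24 + monom (5 ^ 10) 2 * golden ^ 2 * poly_dilate (poly_sect 2 (golden ^ 22))
     + monom (5 ^ 20) 22 * golden ^ 2 = monom 9630720 0 * golden ^ 24"
  by (simp add: golden_def golden5_def poly_sect_pCons monom_altdef power_numeral_even power_numeral_odd)

section \<open>The 5-dissection of the Euler product\<close>

definition eval_int :: "int poly \<Rightarrow> 'a::comm_ring_1 \<Rightarrow> 'a" where
  "eval_int p x = poly (map_poly of_int p) x"

lemma eval_int_0 [simp]: "eval_int 0 x = 0"
  by (simp add: eval_int_def)

lemma eval_int_pCons [simp]: "eval_int (pCons k p) x = of_int k + x * eval_int p x"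
  by (simp add: eval_int_def map_poly_pCons)

lemma eval_int_1 [simp]: "eval_int 1 x = 1"
  by (simp add: one_pCons)

lemma eval_int_add [simp]: "eval_int (p + q) x = eval_int p x + eval_int q x"
  by (induction p q rule: poly_induct2) (simp_all add: algebra_simps)

lemma eval_int_smult [simp]: "eval_int (smult k p) x = of_int k * eval_int p x"
  by (induction p) (simp_all add: algebra_simps)

lemma eval_int_mult [simp]: "eval_int (p * q) x = eval_int p x * eval_int q x"
  by (induction p) (simp_all add: algebra_simps)

lemma eval_int_power [simp]: "eval_int (p ^ n) x = eval_int p x ^ n"
  by (induction n) simp_all

lemma eval_int_monom [simp]: "eval_int (monom k n) x = of_int k * x ^ n"
  by (induction n) (simp_all add: monom_0 monom_Suc algebra_simps)

lemma eval_int_poly_dilate: "eval_int (poly_dilate p) x = eval_int p (x ^ 5)"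
  by (induction p) (simp_all add: algebra_simps eval_nat_numeral)

lemma fps_dilate_of_int: "fps_dilate (of_int k :: 'a::comm_ring_1 fps) = of_int k"
  by (simp flip: fps_of_int)

lemma fps_dilate_add: "fps_dilate (f + g) = fps_dilate f + fps_dilate g"
  by (rule fps_compose_add_distrib)

lemma fps_dilate_uminus: "fps_dilate (- f) = - fps_dilate f"
  by (rule fps_compose_uminus)

lemma fps_dilate_eval_int: "fps_dilate (eval_int p (f :: 'a::idom fps)) = eval_int p (fps_dilate f)"
  by (induction p) (simp_all add: fps_dilate_add fps_dilate_mult fps_dilate_of_int)

text \<open>With \<open>y = fps_X * fps_dilate c\<close>, section \<open>r\<close> of
  \<open>y ^ (5 m + r)\<close> is \<open>c ^ r * (fps_X * c ^ 5) ^ m\<close>. Sectioning series thus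
  reduces to sectioning polynomials.\<close>

lemma fps_sect_eval_int:
  fixes g c :: "'a::idom fps"
  assumes "r < 5"
  shows "fps_sect r (fps_dilate g * eval_int p (fps_X * fps_dilate c)) = g * c ^ r * eval_int (poly_sect r p) (fps_X * c ^ 5)"
  using assms
proof (induction p arbitrary: g r)
  case 0
  show ?case by (simp add: fps_eq_iff)
next
  case (pCons k p)
  let ?y = "fps_X * fps_dilate c"
  have "fps_dilate g * eval_int (pCons k p) ?y = fps_dilate (g * of_int k) + fps_X * (fps_dilate (g * c) * eval_int p ?y)"
    by (simp add: fps_dilate_mult fps_dilate_of_int algebra_simps)
  then have *: "fps_sect s (fps_dilate g * eval_int (pCons k p) ?y)
      = fps_sect s (fps_dilate (g * of_int k)) + fps_sect s (fps_X * (fps_dilate (g * c) * eval_int p ?y))" for s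
    by (simp only: fps_sect_add)
  show ?case
  proof (cases r)
    case 0
    have "c ^ 5 = c * c ^ 4" by (simp add: eval_nat_numeral)
    then show ?thesis using 0
      by (simp only: * fps_sect_dilate fps_sect_X_mult_0) (simp add: pCons.IH poly_sect_pCons_0 algebra_simps)
  next
    case (Suc s)
    then show ?thesis using pCons.prems
      by (simp only: * fps_sect_dilate_Suc fps_sect_X_mult_Suc) (simp add: pCons.IH poly_sect_pCons_Suc algebra_simps)
  qed
qed

lemma fps_sect_X_power_dilate:
  "k < 5 \<Longrightarrow> r < 5 \<Longrightarrow> fps_sect r (fps_X ^ k * fps_dilate f) = (if k = r then f else 0)"
  by (simp add: fps_eq_iff fps_X_power_dilate_nth)

text \<open>In the cube of \<open>\<alpha> - X \<phi> + X^2 \<gamma>\<close>, class 2 modulo 5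
  contributes \<open>3 \<alpha> (\<alpha> \<gamma> + \<phi>^2)\<close>. Jacobi's formula makes it
  vanish, and \<open>\<alpha>\<close> has constant term 1.\<close>

lemma euler_sect_relation:
  "fps_sect 0 euler * fps_sect 2 euler = - (fps_dilate euler ^ 2 :: 'a::field_char_0 fps)"
proof -
  define \<alpha> \<gamma> \<phi> :: "'a fps"
    where "\<alpha> = fps_sect 0 euler" and "\<gamma> = fps_sect 2 euler" and "\<phi> = fps_dilate euler"
  let ?V = "fps_dilate :: 'a fps \<Rightarrow> 'a fps" and ?X = "fps_X :: 'a fps"
  have e: "euler = ?V \<alpha> - ?X * ?V \<phi> + ?X ^ 2 * ?V \<gamma>"
    unfolding \<alpha>_def \<gamma>_def \<phi>_def
    by (subst fps_sect_decomposition) (simp add: fps_sect_euler_1 fps_sect_euler_34 fps_dilate_uminus del: One_nat_def)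
  have X5: "?V ?X = ?X ^ 5" by simp
  have "euler ^ 3 = ?X ^ 0 * ?V (\<alpha> ^ 3 - 3 * ?X * \<phi> * \<gamma> ^ 2) + ?X ^ 1 * ?V (?X * \<gamma> ^ 3 - 3 * \<alpha> ^ 2 * \<phi>)
      + ?X ^ 2 * ?V (3 * \<alpha> * (\<alpha> * \<gamma> + \<phi> ^ 2)) + ?X ^ 3 * ?V (- (\<phi> ^ 3) - 6 * \<alpha> * \<phi> * \<gamma>)
      + ?X ^ 4 * ?V (3 * \<alpha> * \<gamma> ^ 2 + 3 * \<phi> ^ 2 * \<gamma>)"
    unfolding e using fps_dilate_of_int[of 3, where ?'a='a] fps_dilate_of_int[of 6, where ?'a='a]
    by (simp add: fps_dilate_mult fps_dilate_add fps_dilate_power fps_compose_sub_distrib X5 fps_dilate_uminus)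
      algebra
  then have "fps_sect 2 (euler ^ 3) = 3 * \<alpha> * (\<alpha> * \<gamma> + \<phi> ^ 2)"
    by (simp only: fps_sect_add fps_sect_X_power_dilate) simp
  then have "\<alpha> * (\<alpha> * \<gamma> + \<phi> ^ 2) = 0"
    by (simp add: fps_sect_2_euler_cube)
  moreover have "\<alpha> $ 0 = 1" by (simp add: \<alpha>_def)
  then have "\<alpha> \<noteq> 0" by auto
  ultimately show ?thesis by (simp add: \<alpha>_def \<gamma>_def \<phi>_def eq_neg_iff_add_eq_0)
qed

lemma euler_dissection:
  defines "\<alpha> \<equiv> fps_sect 0 euler :: 'a::field_char_0 fps"
  defines "c \<equiv> fps_dilate euler * inverse \<alpha>"
  shows "euler = fps_dilate \<alpha> * eval_int golden (fps_X * fps_dilate c)" and "\<alpha> * c = fps_dilate euler"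
proof -
  have "\<alpha> $ 0 = 1" by (simp add: \<alpha>_def)
  then have inv: "\<alpha> * inverse \<alpha> = 1" by (intro inverse_mult_eq_1') simp
  then show c: "\<alpha> * c = fps_dilate euler" by (simp add: c_def mult_ac)
  have "fps_sect 2 euler = - (fps_dilate euler ^ 2) * inverse \<alpha>"
    using euler_sect_relation[where ?'a='a] inv unfolding \<alpha>_def [symmetric] by algebra
  also have "\<dots> = - (\<alpha> * c ^ 2)"
    unfolding c [symmetric] using inv by algebra
  finally have g: "fps_sect 2 euler = - (\<alpha> * c ^ 2)" .
  have "euler = fps_dilate \<alpha> - fps_X * fps_dilate (\<alpha> * c) - fps_X ^ 2 * fps_dilate (\<alpha> * c ^ 2)"
    unfolding c
    by (subst fps_sect_decomposition)
      (simp add: fps_sect_euler_1 fps_sect_euler_34 fps_dilate_uminus g \<alpha>_def del: One_nat_def)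
  then show "euler = fps_dilate \<alpha> * eval_int golden (fps_X * fps_dilate c)"
    by (simp add: golden_def fps_dilate_mult fps_dilate_power algebra_simps power2_eq_square)
qed

section \<open>The norm over the fifth roots of unity\<close>

lemma prod_lessThan_5: "(\<Prod>k<5. f k) = f 0 * f 1 * f 2 * f 3 * f (4 :: nat)"
  by (simp add: eval_nat_numeral mult_ac)

definition \<zeta> :: complex where "\<zeta> = cis (2 * pi / 5)"

lemma zeta_power_5: "\<zeta> ^ 5 = 1"
  by (simp add: \<zeta>_def DeMoivre)

lemma zeta_sum: "1 + \<zeta> + \<zeta> ^ 2 + \<zeta> ^ 3 + \<zeta> ^ 4 = 0"
proof -
  have "\<zeta> \<noteq> 1"
  proof
    assume "\<zeta> = 1"
    then have "cos (2 * pi / 5) = 1" by (simp add: \<zeta>_def complex_eq_iff)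
    moreover have "cos (2 * pi / 5) < cos 0" by (rule cos_monotone_0_pi) auto
    ultimately show False by simp
  qed
  moreover have "(\<zeta> - 1) * (1 + \<zeta> + \<zeta> ^ 2 + \<zeta> ^ 3 + \<zeta> ^ 4) = 0"
    using zeta_power_5 by (simp add: algebra_simps eval_nat_numeral)
  ultimately show ?thesis by simp
qed

lemma zeta_power_sum:
  assumes "\<not> 5 dvd n"
  shows "1 + \<zeta> ^ n + (\<zeta> ^ n) ^ 2 + (\<zeta> ^ n) ^ 3 + (\<zeta> ^ n) ^ 4 = 0"
proof -
  have "\<zeta> ^ n = \<zeta> ^ (5 * (n div 5) + n mod 5)" by simp
  then have n: "\<zeta> ^ n = \<zeta> ^ (n mod 5)"
    by (simp only: power_add power_mult zeta_power_5) simp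
  have "n mod 5 < 5" by simp
  then have "n mod 5 = 1 \<or> n mod 5 = 2 \<or> n mod 5 = 3 \<or> n mod 5 = 4"
    using assms by presburger
  then have "\<zeta> ^ n = \<zeta> \<or> \<zeta> ^ n = \<zeta> ^ 2 \<or> \<zeta> ^ n = \<zeta> ^ 3 \<or> \<zeta> ^ n = \<zeta> ^ 4"
    unfolding n by auto
  moreover have "1 + w + w ^ 2 + w ^ 3 + w ^ 4 = 0"
    if "w = \<zeta> \<or> w = \<zeta> ^ 2 \<or> w = \<zeta> ^ 3 \<or> w = \<zeta> ^ 4" for w
    using that
  proof (elim disjE)
    assume "w = \<zeta> ^ 2" then show ?thesis using zeta_sum zeta_power_5 by algebra
  next
    assume "w = \<zeta> ^ 3" then show ?thesis using zeta_sum zeta_power_5 by algebra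
  next
    assume "w = \<zeta> ^ 4" then show ?thesis using zeta_sum zeta_power_5 by algebra
  qed (simp add: zeta_sum)
  ultimately show ?thesis by blast
qed

lemma prod_root_of_unity_linear:
  fixes w Y :: "'a::idom"
  assumes "1 + w + w ^ 2 + w ^ 3 + w ^ 4 = 0"
  shows "(\<Prod>k<5. 1 - w ^ k * Y) = 1 - Y ^ 5"
  using assms unfolding prod_lessThan_5 by algebra

text \<open>If \<open>1 - Y - Y^2 = (1 - s Y) (1 - t Y)\<close>, the product is
  \<open>(1 - s^5 Y^5) (1 - t^5 Y^5)\<close>. Here \<open>s t = -1\<close>, and
  \<open>s^5 + t^5\<close> is the Lucas number 11.\<close>

lemma prod_root_of_unity_quadratic:
  fixes w Y :: "'a::idom"
  assumes "1 + w + w ^ 2 + w ^ 3 + w ^ 4 = 0"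
  shows "(\<Prod>k<5. 1 - w ^ k * Y - (w ^ k * Y) ^ 2) = 1 - 11 * Y ^ 5 - Y ^ 10"
  using assms unfolding prod_lessThan_5 by algebra

text \<open>The norm from series in q down to series in \<open>q ^ 5\<close>, the conjugates being
  obtained by rotating q by powers of \<zeta>.\<close>

definition fps_norm :: "complex fps \<Rightarrow> complex fps" where
  "fps_norm f = (\<Prod>k<5. f oo (fps_const (\<zeta> ^ k) * fps_X))"

lemma fps_norm_mult: "fps_norm (f * g) = fps_norm f * fps_norm g"
  by (simp add: fps_norm_def fps_compose_mult_distrib prod.distrib)

lemma fps_dilate_rotate: "fps_dilate f oo (fps_const (\<zeta> ^ k) * fps_X) = fps_dilate f"
proof -
  have "\<zeta> ^ (k * (5 * n)) = 1" for n
    by (metis mult.left_commute mult.commute power_mult power_one zeta_power_5)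
  then show ?thesis
    by (auto simp: fps_eq_iff fps_nth_compose_X_power simp flip: power_mult elim!: dvdE)
qed

lemma fps_norm_dilate: "fps_norm (fps_dilate f) = fps_dilate f ^ 5"
  by (simp add: fps_norm_def fps_dilate_rotate)

lemma fps_norm_one_minus_X_power:
  "fps_norm (1 - fps_X ^ n) = (if 5 dvd n then (1 - fps_X ^ n) ^ 5 else 1 - fps_X ^ (5 * n))"
proof (cases "5 dvd n")
  case True
  then obtain m where "n = 5 * m" ..
  then have "1 - fps_X ^ n = fps_dilate (1 - fps_X ^ m :: complex fps)"
    by (simp add: fps_compose_sub_distrib fps_dilate_X_power del: fps_X_power_compose)
  then show ?thesis using True by (simp add: fps_norm_dilate)
next
  case False
  let ?w = "fps_const (\<zeta> ^ n)"
  have "(1 - fps_X ^ n) oo (fps_const (\<zeta> ^ k) * fps_X) = 1 - ?w ^ k * fps_X ^ n" for k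
    by (auto simp: fps_eq_iff simp flip: power_mult) (simp add: mult.commute)
  then have "fps_norm (1 - fps_X ^ n) = (\<Prod>k<5. 1 - ?w ^ k * fps_X ^ n)"
    by (simp add: fps_norm_def)
  also have "\<dots> = 1 - (fps_X ^ n) ^ 5"
  proof (rule prod_root_of_unity_linear)
    have "1 + ?w + ?w ^ 2 + ?w ^ 3 + ?w ^ 4 = fps_const (1 + \<zeta> ^ n + (\<zeta> ^ n) ^ 2 + (\<zeta> ^ n) ^ 3 + (\<zeta> ^ n) ^ 4)"
      by (simp add: fps_eq_iff)
    then show "1 + ?w + ?w ^ 2 + ?w ^ 3 + ?w ^ 4 = 0"
      using zeta_power_sum[OF False] by simp
  qed
  finally show ?thesis using False by (simp add: mult.commute flip: power_mult)
qed

text \<open>Factors with index divisible by 5 contribute fifth powers, the others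
  \<open>1 - fps_X ^ (5 * i)\<close>. In the limit the norm of E(q) is
  \<open>E(q^5)^6 / E(q^25)\<close>; cross-multiplying avoids the quotient.\<close>

lemma fps_norm_euler_prod:
  "fps_norm (euler_prod (5 * n)) * fps_dilate (fps_dilate (euler_prod n))
     = fps_dilate (euler_prod n) ^ 5 * fps_dilate (euler_prod (5 * n))"
proof (induction n)
  case 0
  show ?case by (simp add: fps_norm_def)
next
  case (Suc n)
  have P: "euler_prod (5 * Suc n) = (euler_prod (5 * n) * (1 - fps_X ^ (5 * n + 1)) * (1 - fps_X ^ (5 * n + 2))
      * (1 - fps_X ^ (5 * n + 3)) * (1 - fps_X ^ (5 * n + 4)) * (1 - fps_X ^ (5 * Suc n)) :: complex fps)"
    by (simp add: euler_prod_Suc flip: Suc_eq_plus1 add: eval_nat_numeral del: power_Suc)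
  have N: "fps_norm (1 - fps_X ^ (5 * n + 1)) = 1 - fps_X ^ (5 * (5 * n + 1))"
      "fps_norm (1 - fps_X ^ (5 * n + 2)) = 1 - fps_X ^ (5 * (5 * n + 2))"
      "fps_norm (1 - fps_X ^ (5 * n + 3)) = 1 - fps_X ^ (5 * (5 * n + 3))"
      "fps_norm (1 - fps_X ^ (5 * n + 4)) = 1 - fps_X ^ (5 * (5 * n + 4))"
    unfolding fps_norm_one_minus_X_power by (rule if_not_P, presburger)+
  have N5: "fps_norm (1 - fps_X ^ (5 * Suc n)) = (1 - fps_X ^ (5 * Suc n)) ^ 5"
    unfolding fps_norm_one_minus_X_power by simp
  have D: "fps_dilate (1 - fps_X ^ k) = (1 - fps_X ^ (5 * k) :: complex fps)" for k
    by (simp only: fps_compose_sub_distrib fps_dilate_X_power fps_compose_1)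
  have rearrange: "A * B = C * E \<Longrightarrow> A * x1 * x2 * x3 * x4 * t * (B * x5) = C * t * (E * x1 * x2 * x3 * x4 * x5)"
    for A B C E x1 x2 x3 x4 x5 t :: "complex fps"
    by algebra
  show ?case
    unfolding P euler_prod_Suc fps_norm_mult fps_dilate_mult D N N5 power_mult_distrib
    by (rule rearrange) (rule Suc.IH)
qed

lemma eq_upto_fps_norm: "eq_upto n f g \<Longrightarrow> eq_upto n (fps_norm f) (fps_norm g)"
  unfolding fps_norm_def by (rule eq_upto_prod) (simp add: eq_upto_def)

lemma eq_upto_fps_dilate: "eq_upto n f g \<Longrightarrow> eq_upto n (fps_dilate f) (fps_dilate g)"
  by (simp add: eq_upto_def fps_nth_compose_X_power)

lemma fps_norm_euler:
  "fps_norm euler * fps_dilate (fps_dilate euler) = fps_dilate euler ^ 6"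
proof (rule eq_uptoI_all)
  fix n
  have e: "eq_upto n euler (euler_prod (5 * n) :: complex fps)" "eq_upto n euler (euler_prod n :: complex fps)"
    by (simp_all add: eq_upto_euler)
  have "eq_upto n (fps_norm euler * fps_dilate (fps_dilate euler))
      (fps_norm (euler_prod (5 * n)) * fps_dilate (fps_dilate (euler_prod n)))"
    by (intro eq_upto_mult eq_upto_fps_norm eq_upto_fps_dilate e)
  also have "\<dots> = fps_dilate (euler_prod n) ^ 5 * fps_dilate (euler_prod (5 * n))"
    by (rule fps_norm_euler_prod)
  also have "eq_upto n \<dots> (fps_dilate euler ^ 5 * fps_dilate euler)"
    by (intro eq_upto_mult eq_upto_power eq_upto_fps_dilate e [THEN eq_upto_sym])
  also have "fps_dilate euler ^ 5 * fps_dilate euler = (fps_dilate euler ^ 6 :: complex fps)"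
    by (simp add: eval_nat_numeral)
  finally show "eq_upto n (fps_norm euler * fps_dilate (fps_dilate euler)) (fps_dilate euler ^ 6)" .
qed

text \<open>Two evaluations of the norm of \<open>euler\<close> are compared, by its product and by
  its dissection. Both are series in \<open>fps_X ^ 5\<close>, so the dilation can be
  removed.\<close>

lemma euler_power_6:
  fixes \<alpha> c :: "complex fps"
  assumes "euler = fps_dilate \<alpha> * eval_int golden (fps_X * fps_dilate c)"
  shows "euler ^ 6 = \<alpha> ^ 5 * eval_int golden5 (fps_X * c ^ 5) * fps_dilate euler"
proof (rule fps_dilate_inj)
  let ?y = "fps_X * fps_dilate c"
  have r: "(fps_const (\<zeta> ^ k) * fps_X :: complex fps) $ 0 = 0" for k by simp
  have "eval_int golden ?y oo (fps_const (\<zeta> ^ k) * fps_X) = 1 - fps_const \<zeta> ^ k * ?y - (fps_const \<zeta> ^ k * ?y) ^ 2" for k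
  proof -
    let ?R = "fps_const (\<zeta> ^ k) * fps_X"
    have "?y oo ?R = fps_const \<zeta> ^ k * ?y"
      by (simp only: fps_compose_mult_distrib[OF r] fps_dilate_rotate fps_X_fps_compose_startby0[OF r] fps_const_power mult.assoc)
    moreover have "eval_int golden ?y = 1 - ?y - ?y ^ 2"
      by (simp add: golden_def algebra_simps power2_eq_square)
    ultimately show ?thesis
      by (simp only: fps_compose_sub_distrib fps_compose_power[OF r, symmetric] fps_compose_1)
  qed
  then have "fps_norm (eval_int golden ?y) = (\<Prod>k<5. 1 - fps_const \<zeta> ^ k * ?y - (fps_const \<zeta> ^ k * ?y) ^ 2)"
    by (simp add: fps_norm_def)
  also have "\<dots> = 1 - 11 * ?y ^ 5 - ?y ^ 10"
  proof (rule prod_root_of_unity_quadratic)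
    have "1 + fps_const \<zeta> + fps_const \<zeta> ^ 2 + fps_const \<zeta> ^ 3 + fps_const \<zeta> ^ 4
        = fps_const (1 + \<zeta> + \<zeta> ^ 2 + \<zeta> ^ 3 + \<zeta> ^ 4)"
      by (simp add: fps_eq_iff)
    then show "1 + fps_const \<zeta> + fps_const \<zeta> ^ 2 + fps_const \<zeta> ^ 3 + fps_const \<zeta> ^ 4 = 0"
      using zeta_sum by simp
  qed
  also have "\<dots> = eval_int golden5 (?y ^ 5)"
    by (simp add: golden5_def algebra_simps flip: power_add)
  also have "?y ^ 5 = fps_dilate (fps_X * c ^ 5)"
    by (simp add: fps_dilate_mult fps_dilate_power power_mult_distrib)
  finally have "fps_norm euler = fps_dilate (\<alpha> ^ 5 * eval_int golden5 (fps_X * c ^ 5))"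
    by (subst assms) (simp add: fps_norm_mult fps_norm_dilate fps_dilate_mult fps_dilate_power fps_dilate_eval_int)
  then show "fps_dilate (euler ^ 6) = fps_dilate (\<alpha> ^ 5 * eval_int golden5 (fps_X * c ^ 5) * fps_dilate euler)"
    using fps_norm_euler by (simp add: fps_dilate_mult fps_dilate_power)
qed

section \<open>The Hecke relation\<close>

lemma fps_sect_diff: "fps_sect r (f - g) = fps_sect r f - fps_sect r g"
  by (simp add: fps_eq_iff)

lemma fps_sect_numeral_mult: "fps_sect r (numeral k * f) = numeral k * fps_sect r f"
  by (simp add: fps_eq_iff numeral_fps_const)

text \<open>The double section selects the index \<open>5 (5 n + 4) + 2 = 25 n + 22\<close>.
  Multiplication by \<open>euler ^ 2\<close> raises the power to 24, a multiple of 6, so that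
  \<open>euler_power_6\<close> applies.\<close>

lemma hecke_fps:
  defines "f \<equiv> (euler :: complex fps) ^ 22"
  shows "fps_sect 4 (fps_sect 2 f) + 5 ^ 10 * f + 5 ^ 10 * (fps_X ^ 2 * fps_dilate (fps_sect 2 f))
           + 5 ^ 20 * (fps_X ^ 22 * fps_dilate (fps_dilate f)) = 9630720 * f"
proof -
  define \<alpha> :: "complex fps" where "\<alpha> = fps_sect 0 euler"
  define c where "c = fps_dilate euler * inverse \<alpha>"
  define e where "e = (euler :: complex fps)"
  define \<phi> where "\<phi> = fps_dilate e"
  define y where "y = fps_X * fps_dilate c"
  define u where "u = fps_X * c ^ 5"
  define w where "w = eval_int golden5 u"
  define p where "p = eval_int golden y"
  have e: "e = fps_dilate \<alpha> * p" and \<phi>: "\<phi> = \<alpha> * c"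
    using euler_dissection[where ?'a = complex] by (simp_all add: \<phi>_def e_def \<alpha>_def c_def p_def y_def)
  have e6: "e ^ 6 = \<alpha> ^ 6 * c * w"
    using euler_power_6[of \<alpha> c] e \<phi>
    by (simp add: \<phi>_def e_def p_def y_def w_def u_def eval_nat_numeral mult_ac)
  have f: "f = e ^ 22" by (simp add: f_def e_def)
  have "c $ 0 = 1" by (simp add: c_def \<alpha>_def fps_nth_compose_X_power)
  then have c0: "c \<noteq> 0" by auto
  have "e \<noteq> 0" using euler_nth_0[where ?'a = complex] by (auto simp: e_def simp del: euler_nth_0)

  \<comment> \<open>The factor \<open>c ^ k\<close> is needed to complete \<open>fps_X ^ k\<close>
    to \<open>y ^ k\<close>.\<close>
  have poly_sect: "c ^ k * fps_sect r (fps_X ^ k * e ^ m) = \<alpha> ^ m * c ^ r * eval_int (poly_sect r (monom 1 k * golden ^ m)) u"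
    if "r < 5" for r k m
  proof -
    have "c ^ k * fps_sect r (fps_X ^ k * e ^ m) = fps_sect r (fps_dilate (c ^ k) * (fps_X ^ k * e ^ m))"
      using that by (simp add: fps_sect_mult_dilate)
    also have "fps_dilate (c ^ k) * (fps_X ^ k * e ^ m) = fps_dilate (\<alpha> ^ m) * eval_int (monom 1 k * golden ^ m) y"
      by (simp add: e p_def y_def fps_dilate_power power_mult_distrib mult_ac)
    also have "fps_sect r \<dots> = \<alpha> ^ m * c ^ r * eval_int (poly_sect r (monom 1 k * golden ^ m)) u"
      unfolding y_def u_def using that by (rule fps_sect_eval_int)
    finally show ?thesis .
  qed
  define D where "D = fps_sect 2 f"
  have D: "D = \<alpha> ^ 22 * c ^ 2 * eval_int (poly_sect 2 (golden ^ 22)) u"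
    using poly_sect[of 2 0 22] by (simp add: D_def f)
  have D': "D = \<alpha> ^ 22 * c ^ 2 * (209 * w ^ 4 + 52250 * u * w ^ 3 + 653125 * u ^ 2 * w ^ 2 - 9765625 * u ^ 4)"
    unfolding D poly_sect_2_golden_power by (simp add: w_def algebra_simps eval_nat_numeral)
  \<comment> \<open>Homogeneity of degree 4 in \<open>u\<close> and \<open>w\<close> is what
    matters: \<open>\<alpha> ^ 24 * c ^ 4 * u ^ i * w ^ (4 - i)\<close> equals
    \<open>fps_X ^ i * \<phi> ^ (6 * i) * (e ^ 6) ^ (4 - i)\<close>.\<close>
  have "\<phi> ^ 2 * D = 209 * (e ^ 6) ^ 4 + 52250 * (\<phi> ^ 6 * (fps_X * (e ^ 6) ^ 3))
      + 653125 * (\<phi> ^ 12 * (fps_X ^ 2 * (e ^ 6) ^ 2)) - 9765625 * (\<phi> ^ 24 * fps_X ^ 4)"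
    unfolding D' e6 \<phi> u_def by algebra
  then have "fps_dilate (e ^ 2) * D = 209 * e ^ 24 + 52250 * (fps_dilate (e ^ 6) * (fps_X * e ^ 18))
      + 653125 * (fps_dilate (e ^ 12) * (fps_X ^ 2 * e ^ 12)) - 9765625 * (fps_dilate (e ^ 24) * fps_X ^ 4)"
    by (simp add: \<phi>_def fps_dilate_power flip: power_mult)
  then have "fps_sect 4 (fps_dilate (e ^ 2) * D) = 209 * fps_sect 4 (fps_X ^ 0 * e ^ 24)
      + 52250 * (e ^ 6 * fps_sect 4 (fps_X ^ 1 * e ^ 18))
      + 653125 * (e ^ 12 * fps_sect 4 (fps_X ^ 2 * e ^ 12)) - 9765625 * (e ^ 24 * fps_sect 4 (fps_X ^ 4 * e ^ 0))"
    by (simp add: fps_sect_add fps_sect_diff fps_sect_numeral_mult fps_sect_mult_dilate)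
  then have sect_4_D: "e ^ 2 * fps_sect 4 D = 209 * fps_sect 4 (fps_X ^ 0 * e ^ 24)
      + 52250 * (e ^ 6 * fps_sect 4 (fps_X ^ 1 * e ^ 18))
      + 653125 * (e ^ 12 * fps_sect 4 (fps_X ^ 2 * e ^ 12)) - 9765625 * (e ^ 24 * fps_sect 4 (fps_X ^ 4 * e ^ 0))"
    by (simp add: fps_sect_mult_dilate)
  have less_5: "(4::nat) < 5" by simp
  have e12: "e ^ 12 = (e ^ 6) ^ 2" and e24: "e ^ 24 = (e ^ 6) ^ 4"
    by (simp_all flip: power_mult)
  \<comment> \<open>A common factor \<open>c ^ 4\<close> provides the \<open>c ^ i\<close> that
    \<open>poly_sect\<close> requires in each term; it is cancelled at the end.\<close>
  have rearrange: "c ^ 4 * (209 * x0 + 52250 * (z1 * x1) + 653125 * (z2 * x2) - 9765625 * (z4 * x4))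
      = 209 * c ^ 4 * (c ^ 0 * x0) + 52250 * c ^ 3 * z1 * (c ^ 1 * x1)
        + 653125 * c ^ 2 * z2 * (c ^ 2 * x2) - 9765625 * z4 * (c ^ 4 * x4)"
    for x0 x1 x2 x4 z1 z2 z4 :: "complex fps"
    by algebra
  have "c ^ 4 * (e ^ 2 * fps_sect 4 D) = 209 * c ^ 4 * (c ^ 0 * fps_sect 4 (fps_X ^ 0 * e ^ 24))
      + 52250 * c ^ 3 * e ^ 6 * (c ^ 1 * fps_sect 4 (fps_X ^ 1 * e ^ 18))
      + 653125 * c ^ 2 * e ^ 12 * (c ^ 2 * fps_sect 4 (fps_X ^ 2 * e ^ 12))
      - 9765625 * e ^ 24 * (c ^ 4 * fps_sect 4 (fps_X ^ 4 * e ^ 0))"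
    unfolding sect_4_D by (rule rearrange)
  also have "\<dots> = 209 * c ^ 4 * (\<alpha> ^ 24 * c ^ 4 * eval_int (poly_sect 4 (monom 1 0 * golden ^ 24)) u)
      + 52250 * c ^ 3 * (e ^ 6) * (\<alpha> ^ 18 * c ^ 4 * eval_int (poly_sect 4 (monom 1 1 * golden ^ 18)) u)
      + 653125 * c ^ 2 * (e ^ 6) ^ 2 * (\<alpha> ^ 12 * c ^ 4 * eval_int (poly_sect 4 (monom 1 2 * golden ^ 12)) u)
      - 9765625 * (e ^ 6) ^ 4 * (\<alpha> ^ 0 * c ^ 4 * eval_int (poly_sect 4 (monom 1 4 * golden ^ 0)) u)"
    unfolding poly_sect[OF less_5] unfolding e12 e24 ..
  also have "\<dots> = \<alpha> ^ 24 * c ^ 8 * (209 * eval_int (poly_sect 4 (monom 1 0 * golden ^ 24)) u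
      + 52250 * w * eval_int (poly_sect 4 (monom 1 1 * golden ^ 18)) u
      + 653125 * w ^ 2 * eval_int (poly_sect 4 (monom 1 2 * golden ^ 12)) u
      - 9765625 * w ^ 4 * eval_int (poly_sect 4 (monom 1 4 * golden ^ 0)) u)"
    unfolding e6 by algebra
  also have "\<dots> = \<alpha> ^ 24 * c ^ 8 * (- 134905 * w ^ 4 - 2041015625 * u ^ 2 * w ^ 2
      - 20410156250 * u ^ 3 * w - 10205078125 * u ^ 4)"
    using arg_cong[OF poly_sect_4_combination, of "\<lambda>p. eval_int p u"]
    by (simp only: eval_int_add eval_int_mult eval_int_monom eval_int_power w_def) simp
  also have "\<dots> = c ^ 4 * (- 134905 * (e ^ 6) ^ 4 - 2041015625 * (fps_X ^ 2 * \<phi> ^ 12 * (e ^ 6) ^ 2)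
      - 20410156250 * (fps_X ^ 3 * \<phi> ^ 18 * e ^ 6) - 10205078125 * (fps_X ^ 4 * \<phi> ^ 24))"
    unfolding e6 \<phi> u_def by algebra
  finally have U25: "e ^ 2 * fps_sect 4 D = - 134905 * (e ^ 6) ^ 4
      - 2041015625 * (fps_X ^ 2 * \<phi> ^ 12 * (e ^ 6) ^ 2)
      - 20410156250 * (fps_X ^ 3 * \<phi> ^ 18 * e ^ 6) - 10205078125 * (fps_X ^ 4 * \<phi> ^ 24)"
    using c0 by (simp only: mult_cancel_left power_eq_0_iff) simp

  \<comment> \<open>The second half returns to the variable \<open>y\<close>: dilating
    \<open>e6\<close> gives \<open>\<phi> ^ 6 = A ^ 6 * C * W\<close>, so every term becomes
    \<open>A ^ 24\<close> times a polynomial in \<open>y\<close>.\<close>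
  define A where "A = fps_dilate \<alpha>"
  define C where "C = fps_dilate c"
  define W where "W = eval_int (poly_dilate golden5) y"
  have eA: "e = A * p" and yC: "y = fps_X * C"
    by (simp_all add: A_def C_def e y_def)
  have u_dilate: "fps_dilate u = y ^ 5"
    by (simp add: u_def y_def fps_dilate_mult fps_dilate_power power_mult_distrib)
  have phi6: "\<phi> ^ 6 = A ^ 6 * C * W"
    unfolding \<phi>_def fps_dilate_power [symmetric] e6
    by (simp add: fps_dilate_mult fps_dilate_power fps_dilate_eval_int w_def A_def C_def W_def eval_int_poly_dilate u_dilate)
  have "e ^ 2 * fps_sect 4 D = A ^ 24 * (- 134905 * p ^ 24 - 2041015625 * y ^ 2 * p ^ 12 * W ^ 2
      - 20410156250 * y ^ 3 * p ^ 6 * W ^ 3 - 10205078125 * y ^ 4 * W ^ 4)"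
  proof -
    have powers: "\<phi> ^ 12 = (A ^ 6 * C * W) ^ 2" "\<phi> ^ 18 = (A ^ 6 * C * W) ^ 3" "\<phi> ^ 24 = (A ^ 6 * C * W) ^ 4"
      unfolding phi6 [symmetric] by (simp_all flip: power_mult)
    then show ?thesis unfolding U25 unfolding powers eA yC by algebra
  qed
  moreover have "fps_dilate D = A ^ 22 * C ^ 2 * eval_int (poly_dilate (poly_sect 2 (golden ^ 22))) y"
    unfolding D by (simp add: fps_dilate_mult fps_dilate_power fps_dilate_eval_int eval_int_poly_dilate u_dilate A_def C_def)
  then have "e ^ 2 * (fps_X ^ 2 * fps_dilate D) = A ^ 24 * (y ^ 2 * p ^ 2 * eval_int (poly_dilate (poly_sect 2 (golden ^ 22))) y)"
    unfolding eA yC by algebra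
  moreover have "fps_dilate (fps_dilate f) = (A * C) ^ 22"
    by (simp add: f fps_dilate_power \<phi>_def [symmetric] \<phi> A_def C_def fps_dilate_mult)
  then have "e ^ 2 * (fps_X ^ 22 * fps_dilate (fps_dilate f)) = A ^ 24 * (y ^ 22 * p ^ 2)"
    unfolding eA yC by algebra
  moreover have "e ^ 2 * f = A ^ 24 * p ^ 24"
    unfolding f eA by algebra
  moreover have "- 134905 * p ^ 24 - 2041015625 * y ^ 2 * p ^ 12 * W ^ 2
      - 20410156250 * y ^ 3 * p ^ 6 * W ^ 3 - 10205078125 * y ^ 4 * W ^ 4 + 5 ^ 10 * p ^ 24
      + 5 ^ 10 * (y ^ 2 * p ^ 2 * eval_int (poly_dilate (poly_sect 2 (golden ^ 22))) y) + 5 ^ 20 * (y ^ 22 * p ^ 2)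
      = 9630720 * p ^ 24"
    using arg_cong[OF hecke_polynomial_identity, of "\<lambda>p. eval_int p y"]
    by (simp only: eval_int_add eval_int_mult eval_int_monom eval_int_power p_def W_def) (simp add: mult_ac)
  ultimately have "e ^ 2 * (fps_sect 4 D + 5 ^ 10 * f + 5 ^ 10 * (fps_X ^ 2 * fps_dilate D)
           + 5 ^ 20 * (fps_X ^ 22 * fps_dilate (fps_dilate f))) = e ^ 2 * (9630720 * f)"
    by algebra
  then show ?thesis using \<open>e \<noteq> 0\<close> by (simp add: D_def)
qed

text \<open>Complex coefficients were needed only for \<zeta>. The pentagonal theorem gives
  \<open>euler\<close> the same integer coefficients over every ring, so identities descend to the
  integers.\<close>

lemma euler_power_nth_of_int: "(euler ^ k :: 'a::field_char_0 fps) $ n = of_int ((euler ^ k :: int fps) $ n)"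
proof (induction k arbitrary: n)
  case 0
  show ?case by simp
next
  case (Suc k)
  have "(euler :: 'a fps) $ i = of_int (euler $ i)" for i
    by (cases "i \<in> range pent") (auto simp: euler_nth_pent euler_nth_not_pent)
  then show ?case using Suc by (simp add: fps_mult_nth)
qed

text \<open>In terms of \<open>12 n + 11\<close> the index map is multiplication by 25, and the
  conditional terms occur when 5, respectively 25, divides \<open>12 n + 11\<close>. The guard
  \<open>22 \<le> n\<close> excludes truncated subtraction.\<close>

lemma hecke_relation:
  fixes n :: nat
  defines "d \<equiv> \<lambda>n. (euler ^ 22 :: int fps) $ n"
  shows "d (25 * n + 22) + 5 ^ 10 * d n + 5 ^ 10 * (if n mod 5 = 2 then d n else 0)
      + 5 ^ 20 * (if 22 \<le> n \<and> 25 dvd n - 22 then d ((n - 22) div 25) else 0) = 9630720 * d n"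
proof -
  let ?f = "euler ^ 22 :: complex fps"
  have d: "?f $ m = of_int (d m)" for m
    unfolding d_def by (rule euler_power_nth_of_int)
  have V: "(5 ^ k * g :: complex fps) $ m = 5 ^ k * g $ m" "(9630720 * g :: complex fps) $ m = 9630720 * g $ m" for k g m
    by (simp_all add: numeral_fps_const)
  have 1: "fps_sect 4 (fps_sect 2 ?f) $ n = of_int (d (25 * n + 22))"
    unfolding fps_sect_nth d by (simp add: algebra_simps)
  have 2: "(fps_X ^ 2 * fps_dilate (fps_sect 2 ?f)) $ n = of_int (if n mod 5 = 2 then d n else 0)"
  proof (cases "n mod 5 = 2")
    case True
    then obtain m where n: "n = 5 * m + 2" by (metis mult_div_mod_eq)
    have "(fps_X ^ 2 * fps_dilate (fps_sect 2 ?f)) $ n = ?f $ n"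
      unfolding n by (subst fps_X_power_dilate_nth) (simp_all del: fps_X_power_mult_nth)
    then show ?thesis using True by (simp only: d simp_thms if_True)
  next
    case False
    then show ?thesis
      using fps_X_power_dilate_nth[of 2 "n mod 5" "fps_sect 2 ?f" "n div 5"] by simp
  qed
  have 3: "(fps_X ^ 22 * fps_dilate (fps_dilate ?f)) $ n
      = of_int (if 22 \<le> n \<and> 25 dvd n - 22 then d ((n - 22) div 25) else 0)"
    unfolding fps_X_power_mult_nth fps_nth_compose_X_power d by (auto simp: div_mult2_eq elim!: dvdE)
  have "fps_sect 4 (fps_sect 2 ?f) $ n + 5 ^ 10 * ?f $ n + 5 ^ 10 * (fps_X ^ 2 * fps_dilate (fps_sect 2 ?f)) $ n
      + 5 ^ 20 * (fps_X ^ 22 * fps_dilate (fps_dilate ?f)) $ n = 9630720 * ?f $ n"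
    using arg_cong[OF hecke_fps, of "\<lambda>g. g $ n"] by (simp only: fps_add_nth V)
  then have "of_int (d (25 * n + 22) + 5 ^ 10 * d n + 5 ^ 10 * (if n mod 5 = 2 then d n else 0)
      + 5 ^ 20 * (if 22 \<le> n \<and> 25 dvd n - 22 then d ((n - 22) div 25) else 0)) = (of_int (9630720 * d n) :: complex)"
    unfolding 1 2 3 d by (simp only: of_int_add of_int_mult of_int_power of_int_numeral)
  then show ?thesis
    unfolding of_int_eq_iff .
qed

section \<open>Regular partitions modulo a prime\<close>

definition partitions_in :: "nat set \<Rightarrow> nat \<Rightarrow> nat multiset set" where
  "partitions_in S n = {M. set_mset M \<subseteq> S \<and> sum_mset M = n}"

text \<open>Either \<open>s\<close> does not occur or one copy of it is removed; further copies stay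
  allowed. On series this becomes the factor \<open>1 - fps_X ^ s\<close>.\<close>

lemma partitions_in_insert:
  assumes "s \<notin> S"
  shows "partitions_in (insert s S) n =
    partitions_in S n \<union> (if s \<le> n then add_mset s ` partitions_in (insert s S) (n - s) else {})"
proof (rule set_eqI)
  fix M
  show "M \<in> partitions_in (insert s S) n \<longleftrightarrow> M \<in> partitions_in S n \<union>
      (if s \<le> n then add_mset s ` partitions_in (insert s S) (n - s) else {})"
  proof (cases "s \<in># M")
    case True
    then obtain M' where M: "M = add_mset s M'" by (blast dest: multi_member_split)
    then have "M \<in> add_mset s ` A \<longleftrightarrow> M' \<in> A" for A by auto
    then show ?thesis using assms by (auto simp: partitions_in_def M)
  next
    case False
    then show ?thesis by (auto simp: partitions_in_def)
  qed
qed

lemma finite_partitions_in: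
  assumes "finite S" "0 \<notin> S"
  shows "finite (partitions_in S n)"
  using assms
proof (induction S arbitrary: n rule: finite_induct)
  case empty
  have "partitions_in {} n \<subseteq> {{#}}" by (auto simp: partitions_in_def)
  then show ?case by (rule finite_subset) simp
next
  case (insert s S)
  show ?case
  proof (induction n rule: less_induct)
    case (less n)
    have "finite (partitions_in (insert s S) (n - s))" if "s \<le> n"
      using insert.prems that by (intro less) auto
    then show ?case
      using insert by (subst partitions_in_insert) auto
  qed
qed

definition partition_series :: "nat set \<Rightarrow> int fps" where
  "partition_series S = Abs_fps (\<lambda>n. int (card (partitions_in S n)))"

lemma partition_series_insert:
  assumes "finite S" "0 \<notin> insert s S" "s \<notin> S"
  shows "partition_series (insert s S) * (1 - fps_X ^ s) = partition_series S"
proof (rule fps_ext)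
  fix n
  let ?Q = "partitions_in (insert s S)"
  have fin: "finite (partitions_in S m)" "finite (?Q m)" for m
    using assms by (auto intro!: finite_partitions_in)
  have disj: "partitions_in S n \<inter> add_mset s ` A = {}" for A
    using assms by (auto simp: partitions_in_def)
  have "card (?Q n) = card (partitions_in S n) + (if s \<le> n then card (?Q (n - s)) else 0)"
    by (subst partitions_in_insert[OF assms(3)])
      (simp add: card_Un_disjoint fin disj card_image inj_on_def)
  then show "(partition_series (insert s S) * (1 - fps_X ^ s)) $ n = partition_series S $ n"
    by (simp add: partition_series_def right_diff_distrib fps_X_power_mult_right_nth)
qed

lemma partition_series_mult_prod:
  assumes "finite S" "0 \<notin> S"
  shows "partition_series S * (\<Prod>s\<in>S. 1 - fps_X ^ s) = 1"
  using assms
proof (induction S rule: finite_induct)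
  case empty
  have "partitions_in {} n = (if n = 0 then {{#}} else {})" for n
    by (auto simp: partitions_in_def)
  then show ?case by (simp add: partition_series_def fps_eq_iff)
next
  case (insert s S)
  then show ?case
    using partition_series_insert[of S s] by (simp flip: mult.assoc)
qed

section \<open>The generating function of regular partitions and its reduction modulo p\<close>

lemma regular_partitions_eq:
  assumes "n \<le> N"
  shows "regular_partitions l n = partitions_in {s \<in> {1..N}. \<not> l dvd s} n"
proof -
  have "x \<le> sum_mset M" if "x \<in># M" for x :: nat and M
    using multi_member_split[OF that] by auto
  then show ?thesis
    using assms by (fastforce simp: regular_partitions_def partitions_in_def)
qed

definition regular_series :: "nat \<Rightarrow> int fps" where
  "regular_series l = Abs_fps (\<lambda>n. int (b l n))"

lemma eq_upto_regular_series:
  "eq_upto N (regular_series l) (partition_series {s \<in> {1..N}. \<not> l dvd s})"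
  by (simp add: eq_upto_def regular_series_def partition_series_def b_def regular_partitions_eq)

text \<open>The factors of \<open>euler\<close> with index prime to divisibility by \<open>l\<close>
  cancel against the partition series. Truncating at \<open>l * N\<close> leaves exactly
  \<open>N\<close> multiples of \<open>l\<close>.\<close>

lemma eq_upto_regular_series_mult_euler:
  assumes "0 < l"
  shows "eq_upto N (regular_series l * euler) (\<Prod>i=1..N. 1 - fps_X ^ (l * i))"
proof -
  let ?S = "{s \<in> {1..l*N}. \<not> l dvd s}" and ?T = "(*) l ` {1..N}"
  have split: "{1..l*N} = ?S \<union> ?T"
    using assms by (auto elim!: dvdE simp: image_iff)
  have "eq_upto (l * N) (regular_series l * euler) (partition_series ?S * euler_prod (l * N))"
    by (intro eq_upto_mult eq_upto_regular_series eq_upto_euler order_refl)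
  moreover have "euler_prod (l * N) = (\<Prod>s\<in>?S. 1 - fps_X ^ s) * (\<Prod>s\<in>?T. 1 - fps_X ^ s :: int fps)"
    unfolding euler_prod_def by (subst split, rule prod.union_disjoint) auto
  moreover have "(\<Prod>s\<in>?T. 1 - fps_X ^ s :: int fps) = (\<Prod>i=1..N. 1 - fps_X ^ (l * i))"
    using assms by (subst prod.reindex) (auto simp: inj_on_def)
  ultimately have "eq_upto (l * N) (regular_series l * euler) (\<Prod>i=1..N. 1 - fps_X ^ (l * i))"
    using partition_series_mult_prod[of ?S] by (simp flip: mult.assoc)
  then show ?thesis by (rule eq_upto_mono) (use assms in simp)
qed

text \<open>The inner binomial coefficients are divisible by \<open>p\<close>; oddness gives the
  last term its minus sign.\<close>

lemma prime_dvd_one_minus_power: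
  fixes x :: "'a::comm_ring_1"
  assumes "prime p" "odd p"
  shows "of_nat p dvd (1 - x) ^ p - (1 - x ^ p)"
proof -
  have "(1 - x) ^ p = (\<Sum>k\<le>p. of_nat (p choose k) * (- x) ^ k)"
    using binomial_ring[of "- x" 1 p] by simp
  also have "{..p} = insert 0 (insert p {0<..<p})"
    by auto
  also have "(\<Sum>k\<in>\<dots>. of_nat (p choose k) * (- x) ^ k)
      = 1 - x ^ p + (\<Sum>k\<in>{0<..<p}. of_nat (p choose k) * (- x) ^ k)"
    using assms prime_gt_0_nat[of p] by simp
  finally have "(1 - x) ^ p - (1 - x ^ p) = (\<Sum>k\<in>{0<..<p}. of_nat (p choose k) * (- x) ^ k)"
    by simp
  also have "of_nat p dvd \<dots>"
  proof (intro dvd_sum dvd_mult2)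
    fix k assume "k \<in> {0<..<p}"
    then have "p dvd p choose k"
      using assms by (intro dvd_choose_prime) auto
    then show "of_nat p dvd (of_nat (p choose k) :: 'a)"
      by (metis dvd_def of_nat_mult)
  qed
  finally show ?thesis .
qed

lemma dvd_prod_diff:
  fixes f g :: "'b \<Rightarrow> 'a::comm_ring_1"
  assumes "\<And>i. i \<in> S \<Longrightarrow> m dvd f i - g i"
  shows "m dvd prod f S - prod g S"
  using assms
proof (induction S rule: infinite_finite_induct)
  case (insert i S)
  have "prod f (insert i S) - prod g (insert i S) = f i * (prod f S - prod g S) + (f i - g i) * prod g S"
    using insert.hyps by (simp add: algebra_simps)
  then show ?case using insert by simp
qed auto

lemma regular_series_cong:
  assumes "prime p" "odd p"
  shows "[int (b p n) = (euler ^ (p - 1) :: int fps) $ n] (mod int p)"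
proof -
  have const: "(of_nat p * h :: int fps) $ m = int p * h $ m" for h m
    by simp
  have "int p dvd (regular_series p * euler - euler ^ p) $ m" for m
  proof -
    let ?P = "\<Prod>i=1..m. 1 - fps_X ^ (p * i) :: int fps"
    have "of_nat p dvd (\<Prod>i=1..m. (1 - fps_X ^ i) ^ p) - ?P"
    proof (rule dvd_prod_diff)
      fix i
      show "of_nat p dvd (1 - fps_X ^ i) ^ p - (1 - fps_X ^ (p * i) :: int fps)"
        using prime_dvd_one_minus_power[OF assms, of "fps_X ^ i :: int fps"]
        by (simp add: mult.commute flip: power_mult)
    qed
    then obtain h where "euler_prod m ^ p - ?P = of_nat p * h"
      unfolding euler_prod_def prod_power_distrib by (rule dvdE)
    then have "(euler_prod m ^ p) $ m - ?P $ m = int p * h $ m"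
      by (metis const fps_sub_nth)
    moreover have "(regular_series p * euler) $ m = ?P $ m"
      using eq_upto_regular_series_mult_euler[of p m] prime_gt_0_nat[OF assms(1)] by (simp add: eq_upto_def)
    moreover have "(euler ^ p) $ m = (euler_prod m ^ p :: int fps) $ m"
      using eq_upto_power[OF eq_upto_euler[where ?'a = int, of m m]] by (simp add: eq_upto_def)
    ultimately have "(regular_series p * euler - euler ^ p) $ m = int p * (- h $ m)" by simp
    then show ?thesis by simp
  qed
  then have "int p dvd ((regular_series p * euler - euler ^ p) * g) $ n" for g
    unfolding fps_mult_nth by (intro dvd_sum dvd_mult2)
  \<comment> \<open>The constant term 1 makes \<open>euler\<close> invertible over the integers, and
    multiplying by the inverse keeps all coefficients divisible by \<open>p\<close>.\<close>
  moreover obtain g :: "int fps" where g: "euler * g = 1"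
    using fps_right_inverse[of euler "1::int"] by auto
  have "euler ^ p = euler ^ (p - 1) * (euler :: int fps)"
    using prime_gt_0_nat[OF assms(1)] by (simp flip: power_Suc2)
  then have "(regular_series p * euler - euler ^ p) * g = (regular_series p - euler ^ (p - 1)) * (euler * g)"
    by (simp add: algebra_simps)
  ultimately show ?thesis
    unfolding g mult_1_right by (metis cong_iff_dvd_diff fps_nth_Abs_fps fps_sub_nth regular_series_def)
qed

section \<open>The recurrence modulo 23\<close>

lemma b23_recurrence:
  fixes n :: nat
  assumes "n mod 5 = 2"
  shows "[int (b 23 (25 * n + 22)) = 4 * int (b 23 n)
    + (if 22 \<le> n \<and> 25 dvd n - 22 then 11 * int (b 23 ((n - 22) div 25)) else 0)] (mod 23)"
proof -
  define d where "d n = (euler ^ 22 :: int fps) $ n" for n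
  have "prime (23::nat)"
    by simp
  then have bd: "[int (b 23 m) = d m] (mod 23)" for m
    using regular_series_cong[of 23 m] by (simp add: d_def)
  let ?z = "if 22 \<le> n \<and> 25 dvd n - 22 then d ((n - 22) div 25) else 0"
  have "d (25 * n + 22) + 5 ^ 10 * d n + 5 ^ 10 * d n + 5 ^ 20 * ?z = 9630720 * d n"
    using hecke_relation[of n] unfolding assms d_def by (simp only: simp_thms if_True)
  \<comment> \<open>\<open>9630720 - 2 * 5 ^ 10 = 4 - 23 * 430458\<close> and
    \<open>- (5 ^ 20) = 11 - 23 * 4146410071332\<close>.\<close>
  then have "d (25 * n + 22) - (4 * d n + 11 * ?z) = 23 * (- 430458 * d n - 4146410071332 * ?z)"
    by simp
  then have "[d (25 * n + 22) = 4 * d n + 11 * ?z] (mod 23)"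
    unfolding cong_iff_dvd_diff by (rule dvdI)
  moreover have "[4 * d n + 11 * ?z = 4 * int (b 23 n)
    + (if 22 \<le> n \<and> 25 dvd n - 22 then 11 * int (b 23 ((n - 22) div 25)) else 0)] (mod 23)"
    using bd [THEN cong_sym] by (auto intro!: cong_add cong_scalar_left)
  ultimately show ?thesis
    by (meson bd cong_trans)
qed

text \<open>The \<open>j\<close>-th iterate of \<open>n \<mapsto> 25 n + 22\<close>, characterized
  by \<open>12 * hecke_index n j + 11 = 25 ^ j * (12 n + 11)\<close>. The division is exact because
  \<open>25 ^ j\<close> is 1 modulo 12.\<close>

definition hecke_index :: "nat \<Rightarrow> nat \<Rightarrow> nat" where
  "hecke_index n j = 25 ^ j * n + 11 * (25 ^ j - 1) div 12"

lemma power_25_eq: "\<exists>q. (25::nat) ^ j = 12 * q + 1"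
proof (induction j)
  case (Suc j)
  then obtain q where "25 ^ j = 12 * q + (1::nat)" ..
  then have "25 ^ Suc j = 12 * (25 * q + 2) + (1::nat)" by simp
  then show ?case ..
qed simp

lemma hecke_index_Suc: "hecke_index n (Suc j) = 25 * hecke_index n j + 22"
proof -
  obtain q where q: "25 ^ j = 12 * q + (1::nat)" using power_25_eq by blast
  then have "25 ^ Suc j = 12 * (25 * q + 2) + (1::nat)" by simp
  then show ?thesis unfolding hecke_index_def q by (simp add: algebra_simps)
qed

lemma b23_index_recurrence:
  "[int (b 23 (hecke_index n (j + 2))) = 4 * int (b 23 (hecke_index n (j + 1))) + 11 * int (b 23 (hecke_index n j))] (mod 23)"
proof -
  have "(25 * hecke_index n j + 22) mod 5 = 2" by presburger
  then show ?thesis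
    using b23_recurrence[of "25 * hecke_index n j + 22"] by (simp add: hecke_index_Suc)
qed

text \<open>\<open>a j\<close> and \<open>a (j + 1) / 11\<close> are the solutions with initial
  values 1, 0 and 0, 1. The factor 11 clears the denominator.\<close>

lemma linear_recurrence_closed:
  fixes u :: "nat \<Rightarrow> int"
  assumes "\<And>j. [u (j + 2) = 4 * u (j + 1) + 11 * u j] (mod m)"
  shows "[11 * u j = 11 * a j * u 0 + a (j + 1) * u 1] (mod m)"
proof (induction j rule: a.induct)
  case (3 j)
  have "[11 * u (j + 2) = 11 * (4 * u (j + 1) + 11 * u j)] (mod m)"
    by (intro cong_scalar_left assms)
  also have "11 * (4 * u (j + 1) + 11 * u j) = 4 * (11 * u (j + 1)) + 11 * (11 * u j)"
    by simp
  also have "[\<dots> = 4 * (11 * a (j + 1) * u 0 + a (j + 1 + 1) * u 1) + 11 * (11 * a j * u 0 + a (j + 1) * u 1)] (mod m)"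
    using 3 by (intro cong_add cong_scalar_left) simp_all
  also have "4 * (11 * a (j + 1) * u 0 + a (j + 1 + 1) * u 1) + 11 * (11 * a j * u 0 + a (j + 1) * u 1)
      = 11 * a (j + 2) * u 0 + a (j + 2 + 1) * u 1"
    by (simp add: algebra_simps)
  finally show ?case by simp
qed simp_all

lemma a_13: "23 dvd a 13"
  by (simp add: numeral_eq_Suc)

lemma cong_23_cancel_11: "[11 * x = 11 * y] (mod 23) \<Longrightarrow> [x = y] (mod 23)" for x y :: int
  unfolding cong_iff_dvd_diff by presburger

text \<open>Since 23 divides \<open>a 13\<close>, the closed form loses its second term at index 12.
  A shift by 12 is thus multiplication by \<open>a 12\<close>, for every solution.\<close>

lemma linear_recurrence_shift_12:
  fixes u :: "nat \<Rightarrow> int"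
  assumes "\<And>j. [u (j + 2) = 4 * u (j + 1) + 11 * u j] (mod 23)"
  shows "[u (j + 12 * k) = a 12 ^ k * u j] (mod 23)"
proof (induction k)
  case (Suc k)
  let ?v = "\<lambda>i. u (j + 12 * k + i)"
  have "[?v (i + 2) = 4 * ?v (i + 1) + 11 * ?v i] (mod 23)" for i
    using assms[of "j + 12 * k + i"] by (simp add: add_ac)
  then have "[11 * ?v 12 = 11 * a 12 * ?v 0 + a (12 + 1) * ?v 1] (mod 23)"
    by (rule linear_recurrence_closed)
  also have "[11 * a 12 * ?v 0 + a (12 + 1) * ?v 1 = 11 * (a 12 * ?v 0) + 0] (mod 23)"
    using a_13 by (intro cong_add) (auto simp: cong_0_iff mult.assoc simp del: a.simps)
  finally have "[?v 12 = a 12 * ?v 0] (mod 23)"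
    unfolding add_0_right by (rule cong_23_cancel_11)
  also have "[a 12 * ?v 0 = a 12 * (a 12 ^ k * u j)] (mod 23)"
    using Suc.IH by (intro cong_scalar_left) simp
  finally show ?case by (simp add: algebra_simps del: a.simps)
qed simp

lemma a_multiple_12: "[a (12 * k) = a 12 ^ k] (mod 23)"
  using linear_recurrence_shift_12[of a 0 k] by simp

theorem theorem1p3:
  shows "(\<forall>n k::nat.
            [int (b 23 (5^(24*k) * n + 11 * (5^(24*k) - 1) div 12))
               = a (12*k) * int (b 23 n)] (mod 23))
       \<and> (\<forall>r n k::nat. r \<in> {0,1,2,3} \<longrightarrow>
            [int (b 23 (5^(24*k+24) * n + (5^(24*k+23) * (12*r+7) - 11) div 12)) = 0] (mod 23))"
proof (intro conjI allI impI)
  fix n k :: nat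
  have "5 ^ (24 * k) = (25 :: nat) ^ (12 * k)"
    using power_mult[of "5::nat" 2 "12 * k"] by simp
  then have "5 ^ (24 * k) * n + 11 * (5 ^ (24 * k) - 1) div 12 = hecke_index n (12 * k)"
    by (simp add: hecke_index_def)
  moreover have "[int (b 23 (hecke_index n (0 + 12 * k))) = a 12 ^ k * int (b 23 (hecke_index n 0))] (mod 23)"
    by (rule linear_recurrence_shift_12) (rule b23_index_recurrence)
  moreover have "[a 12 ^ k * int (b 23 n) = a (12 * k) * int (b 23 n)] (mod 23)"
    by (intro cong_scalar_right cong_sym[OF a_multiple_12])
  moreover have "hecke_index n 0 = n" by (simp add: hecke_index_def)
  ultimately show "[int (b 23 (5 ^ (24 * k) * n + 11 * (5 ^ (24 * k) - 1) div 12)) = a (12 * k) * int (b 23 n)] (mod 23)"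
    by (simp only: add_0) (rule cong_trans)
next
  fix r n k :: nat
  assume r: "r \<in> {0, 1, 2, 3}"
  \<comment> \<open>Here \<open>12 m + 11 = 5 (60 n + 12 r + 7)\<close>, and for
    \<open>r \<le> 3\<close> the last factor is not divisible by 5. So \<open>m\<close> is 2 modulo
    5 but not 22 modulo 25.\<close>
  define m where "m = 25 * n + 5 * r + 2"
  let ?v = "\<lambda>j. int (b 23 (hecke_index m j))"
  have eq: "5 ^ (24 * k + 24) * n + (5 ^ (24 * k + 23) * (12 * r + 7) - 11) div 12 = hecke_index m (11 + 12 * k)"
  proof -
    obtain q where q: "25 ^ (11 + 12 * k) = 12 * q + (1::nat)" using power_25_eq by blast
    have "5 ^ (24 * k + 22) = (25 :: nat) ^ (11 + 12 * k)"
      using power_mult[of "5::nat" 2 "11 + 12 * k"] by (simp add: add.commute)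
    then have p: "5 ^ (24 * k + 22) = 12 * q + (1 :: nat)"
      using q by simp
    have "(5 :: nat) ^ (24 * k + 24) = 25 * 5 ^ (24 * k + 22)" "(5 :: nat) ^ (24 * k + 23) = 5 * 5 ^ (24 * k + 22)"
      by (simp_all add: power_add)
    then have "5 ^ (24 * k + 24) = 25 * (12 * q + 1 :: nat)" "5 ^ (24 * k + 23) = 5 * (12 * q + 1 :: nat)"
      unfolding p .
    moreover have "5 * (12 * q + 1) * (12 * r + 7) - 11 = 12 * ((12 * q + 1) * (5 * r + 2) + 11 * q)"
      by (simp add: algebra_simps)
    ultimately show ?thesis
      unfolding hecke_index_def q m_def by (simp add: algebra_simps)
  qed
  have m: "m mod 5 = 2" unfolding m_def by presburger
  have not_dvd: "\<not> (22 \<le> m \<and> 25 dvd m - 22)"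
    using r unfolding m_def by auto presburger+
  have "hecke_index m 0 = m" "hecke_index m 1 = 25 * m + 22"
    by (simp_all add: hecke_index_def)
  then have v1: "[?v 1 = 4 * ?v 0] (mod 23)"
    using b23_recurrence[OF m] unfolding if_not_P[OF not_dvd] by (simp only: add_0_right)
  \<comment> \<open>Starting with \<open>?v 1 = 4 * ?v 0\<close>, the sequence is proportional to
    \<open>a (j + 2)\<close>, so index 11 meets \<open>a 13 = 4 * a 12 + 11 * a 11\<close>.\<close>
  have "[11 * ?v 11 = 11 * a 11 * ?v 0 + a (11 + 1) * ?v 1] (mod 23)"
    by (rule linear_recurrence_closed) (rule b23_index_recurrence)
  also have "[11 * a 11 * ?v 0 + a (11 + 1) * ?v 1 = 11 * a 11 * ?v 0 + a (11 + 1) * (4 * ?v 0)] (mod 23)"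
    by (intro cong_add cong_refl cong_scalar_left v1)
  also have "11 * a 11 * ?v 0 + a (11 + 1) * (4 * ?v 0) = a 13 * ?v 0"
    using a.simps(3)[of 11] by (simp add: algebra_simps eval_nat_numeral del: a.simps)
  also have "[a 13 * ?v 0 = 11 * 0] (mod 23)"
    using a_13 by (simp add: cong_0_iff)
  finally have "[?v 11 = 0] (mod 23)"
    by (rule cong_23_cancel_11)
  moreover have "[?v (11 + 12 * k) = a 12 ^ k * ?v 11] (mod 23)"
    by (rule linear_recurrence_shift_12) (rule b23_index_recurrence)
  ultimately have "[?v (11 + 12 * k) = 0] (mod 23)"
    by (simp add: cong_0_iff cong_dvd_iff del: a.simps)
  then show "[int (b 23 (5 ^ (24 * k + 24) * n + (5 ^ (24 * k + 23) * (12 * r + 7) - 11) div 12)) = 0] (mod 23)"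
    unfolding eq .
qed

end
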